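(* Let $\Delta$ and $\Gamma$ be visibility functions and let $P,Q$ be closed processes with $\Delta\vdash P$ and $\Delta\vdash Q$. Then $P$ and $Q$ are trace equivalent at $\Gamma$ (written $P\approx^{\Delta}_{\Gamma,\mathrm{tr}}Q$) if and only if $P$ and $Q$ are may testing equivalent at $\Gamma$ (written $P\cong^{\Delta}_{\Gamma}Q$).
   Context: Calculus. Names are partitioned into higher-order names $a,b,c,d,\dots$ (set $N_{ho}$), first-order names $h,k$, and success names $\omega$. There are first-order values $v,w$, first-order variables $x,y$, and first-order expressions $e,f$; every closed expression $e$ evaluates to a value ($e\Downarrow v$), and equality of values is decidable. Higher-order names carry a pair (first-order value, higher-order name); first-order names carry one first-order value. Processes: $P::= a(x,b).P \mid h(x).P \mid \overline{a}\langle e\rangle(b).P \mid \overline{h}\langle e\rangle.P \mid \omega.P \mid\ !\alpha.P \mid P|Q \mid \nu a\,P \mid \nu h\,P \mid 0 \mid P+Q \mid \mathtt{if}\ e=f\ \mathtt{then}\ P\ \mathtt{else}\ Q$, where $\alpha$ ranges over input prefixes $a(x,b)$, $h(x)$. In $a(x,b).P$ the names $x,b$ are bound; in $h(x).P$, $x$ is bound; in $\overline a\langle e\rangle(b).P$ (output of $e$ together with a fresh name $b$), $b$ is bound; restrictions bind. Processes are considered up to $\alpha$-conversion and are closed (no free first-order variables). Actions: $\mu::=\tau\mid a\langle v\rangle(b)\mid \overline a\langle v\rangle(b)\mid h\langle v\rangle\mid \overline h\langle v\rangle\mid\omega$ ($b$ bound in the first two). Transitions: $a(x,b).P\xrightarrow{a\langle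 v\rangle(b)}P[v/x]$; $\overline a\langle e\rangle(b).P\xrightarrow{\overline a\langle v\rangle(b)}P$ if $e\Downarrow v$; $h(x).P\xrightarrow{h\langle v\rangle}P[v/x]$; $\overline h\langle e\rangle.P\xrightarrow{\overline h\langle v\rangle}P$ if $e\Downarrow v$; $\omega.P\xrightarrow{\omega}0$; if $\alpha.P\xrightarrow{\mu}Q$ then $!\alpha.P\xrightarrow{\mu}Q\,|\,!\alpha.P$; if $P\xrightarrow{\mu}P'$ and $n$ (higher- or first-order) is not free in $\mu$ then $\nu n P\xrightarrow{\mu}\nu n P'$; if $P\xrightarrow{\mu}P'$ then $P+Q\xrightarrow{\mu}P'$; if $P\xrightarrow{a\langle v\rangle(b)}P'$ and $Q\xrightarrow{\overline a\langle v\rangle(b)}Q'$ then $P|Q\xrightarrow{\tau}\nu b(P'|Q')$; if $P\xrightarrow{h\langle v\rangle}P'$ and $Q\xrightarrow{\overline h\langle v\rangle}Q'$ then $P|Q\xrightarrow{\tau}P'|Q'$; if $P\xrightarrow{\mu}P'$ and no bound name of $\mu$ is free in $Q$ then $P|Q\xrightarrow{\mu}P'|Q$; symmetric versions of the sum and parallel rules; $\mathtt{if}\ e=f\ \mathtt{then}\ P\ \mathtt{else}\ Q$ does the transitions of $P$ if $e,f$ evaluate to the same value and those of $Q$ otherwise. $\Longrightarrow$ is the reflexive-transitive closure of $\xrightarrow{\tau}$; $P\Downarrow_\omega$ means $P\Longrightarrow P'\xrightarrow{\omega}$ for some $P'$. Visibility functions. A visibility function is a finite partial function $\Delta: N_{ho}\cup\{\mathsf{cur}\}\to\mathcal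 P_{fin}(N_{ho})$ ($\mathsf{cur}$ a special token for the active thread) that is transitive: for all $o\in\mathrm{dom}\Delta$ and $a\in\mathrm{dom}\Delta$ with $a\in\Delta(o)$, $\Delta(a)\subseteq\Delta(o)$. Notation: $\Delta,p\mapsto V$ extends $\Delta$ (with $p\notin\mathrm{dom}\Delta$); $\Delta\setminus p$ erases $p$ from the domain and from all values; $V,q$ means $V\cup\{q\}$; $\Delta_1\cup\Delta_2$ has domain $\mathrm{dom}\Delta_1\cup\mathrm{dom}\Delta_2$ and pointwise union of values (undefined read as $\emptyset$). $(\Delta_1,\Delta_2)\in\mathrm{split}(\Delta)$ iff $\Delta_1\cup\Delta_2=\Delta$ and $\mathsf{cur}\notin\mathrm{dom}\Delta_1\cap\mathrm{dom}\Delta_2$. $\Delta_1,\Delta_2$ are compatible iff $\mathsf{cur}\notin\mathrm{dom}\Delta_1\cap\mathrm{dom}\Delta_2$. Typing $\Delta\vdash P$ is the least relation closed under: $\Delta\vdash\overline a\langle e\rangle(b).P$ if $a\in\Delta(\mathsf{cur})$ and $(\Delta\setminus\mathsf{cur}),b\mapsto\Delta(\mathsf{cur})\cup\{b\}\vdash P$; $\Delta\vdash a(x,b).P$ if $\mathsf{cur}\notin\mathrm{dom}\Delta$, $a\in\mathrm{dom}\Delta$ and $\Delta,\mathsf{cur}\mapsto\Delta(a)\cup\{b\}\vdash P$; $\Delta\vdash\overline h\langle e\rangle.P$ if $\Delta\vdash P$ and $\mathsf{cur}\notin\mathrm{dom}\Delta$; $\Delta\vdash h(x).P$ if $\Delta\vdash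 P$ and $\mathsf{cur}\in\mathrm{dom}\Delta$; $\Delta\vdash !\alpha.P$ if $\Delta\vdash\alpha.P$ and $\mathsf{cur}\notin\mathrm{dom}\Delta$; $\Delta\vdash\omega.P$ always; $\Delta\setminus a\vdash\nu a P$ if $\Delta\vdash P$; $\Delta\vdash\nu h P$ if $\Delta\vdash P$; $\Delta\vdash 0$ if $\mathsf{cur}\notin\mathrm{dom}\Delta$; $\Delta\vdash P_1+P_2$ and $\Delta\vdash \mathtt{if}\ e=f\ \mathtt{then}\ P_1\ \mathtt{else}\ P_2$ if $\Delta\vdash P_1$ and $\Delta\vdash P_2$; $\Delta\vdash P_1|P_2$ if $\Delta_1\vdash P_1$, $\Delta_2\vdash P_2$ with $(\Delta_1,\Delta_2)\in\mathrm{split}(\Delta)$. May testing: for compatible $\Delta,\Gamma$ and closed $P,Q$ with $\Delta\vdash P,Q$, $P\cong^\Delta_\Gamma Q$ iff for every closed $R$ with $\Gamma\vdash R$ and every success name $\omega$, $(R|P)\Downarrow_\omega$ iff $(R|Q)\Downarrow_\omega$ (the relation is only defined/holding when $\Delta,\Gamma$ are compatible). Type-allowed transitions $\Gamma: P\xrightarrow{\mu}\Gamma':P'$ ($\Gamma$ the observer's visibility): if $P\xrightarrow{\overline a\langle v\rangle(b)}P'$, $a\in\mathrm{dom}\Gamma$, $\mathsf{cur}\notin\mathrm{dom}\Gamma$, then $\Gamma:P\xrightarrow{\overline a\langle v\rangle(b)}(\Gamma,\mathsf{cur}\mapsto\Gamma(a)\cup\{b\}):P'$; if $P\xrightarrow{a\langle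 v\rangle(b)}P'$ and $a\in\Gamma(\mathsf{cur})$, then $\Gamma:P\xrightarrow{a\langle v\rangle(b)}((\Gamma\setminus\mathsf{cur}),b\mapsto\Gamma(\mathsf{cur})\cup\{b\}):P'$; if $P\xrightarrow{\overline h\langle v\rangle}P'$ and $\mathsf{cur}\in\mathrm{dom}\Gamma$ then $\Gamma:P\xrightarrow{\overline h\langle v\rangle}\Gamma:P'$; if $P\xrightarrow{h\langle v\rangle}P'$ and $\mathsf{cur}\notin\mathrm{dom}\Gamma$ then $\Gamma:P\xrightarrow{h\langle v\rangle}\Gamma:P'$; if $P\xrightarrow{\tau}P'$ and $\mathsf{cur}\notin\mathrm{dom}\Gamma$ then $\Gamma:P\xrightarrow{\tau}\Gamma:P'$. Weak: $\Gamma:P\Longrightarrow\Gamma:P'$ via zero or more typed $\tau$-steps; $\Gamma:P\xRightarrow{\mu}\Gamma':P'$ iff $\Gamma:P\Longrightarrow\Gamma:P''\xrightarrow{\mu}\Gamma':P'''\Longrightarrow\Gamma':P'$. A trace is a finite sequence $\mu_1\dots\mu_n$ of non-$\tau$ actions whose bound names are pairwise distinct and distinct from its free names; it is a trace of $P_0$ under $\Gamma_0$ if there are $P_i,\Gamma_i$ with $\Gamma_{i-1}:P_{i-1}\xRightarrow{\mu_i}\Gamma_i:P_i$ for $1\le i\le n$. For $\Delta$-processes $P,Q$, $P\approx^{\Delta}_{\Gamma,\mathrm{tr}}Q$ iff $\Delta,\Gamma$ are compatible and $P,Q$ have the same traces under $\Gamma$.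
   Formalization: May testing ranges only over success names ω not occurring in P, Q (else ω.0 and 0 have the same traces but are separated by R = 0), and traces are compared only on bound names fresh for P, Q, Δ, Γ (the usual bound-name convention, needed because of the parallel rule's side condition). *)

theory Defs
  imports Main
begin

section \<open>Names, expressions and processes\<close>

type_synonym hname = nat  \<comment> \<open>higher-order names\<close>
type_synonym fname = nat  \<comment> \<open>first-order names\<close>
type_synonym sname = nat  \<comment> \<open>success names\<close>
type_synonym var = nat    \<comment> \<open>first-order variables\<close>

text \<open>First-order expressions are the terms over an arbitrary signature \<open>'f\<close> whose symbols are
  interpreted by an arbitrary \<open>I :: 'f \<Rightarrow> 'v list \<Rightarrow> 'v\<close>; thus every closed expression has a value.
  The value of an open expression is never used for closed processes.\<close>

datatype ('f, 'v) expr = Var var | Val 'v | App 'f "('f, 'v) expr list"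

primrec evars :: "('f, 'v) expr \<Rightarrow> var set" where
  "evars (Var x) = {x}"
| "evars (Val v) = {}"
| "evars (App f es) = \<Union> (set (map evars es))"

primrec esubst :: "var \<Rightarrow> 'v \<Rightarrow> ('f, 'v) expr \<Rightarrow> ('f, 'v) expr" where
  "esubst x v (Var y) = (if y = x then Val v else Var y)"
| "esubst x v (Val w) = Val w"
| "esubst x v (App f es) = App f (map (esubst x v) es)"

primrec eval :: "('f \<Rightarrow> 'v list \<Rightarrow> 'v) \<Rightarrow> ('f, 'v) expr \<Rightarrow> 'v" where
  "eval I (Var x) = undefined"
| "eval I (Val v) = v"
| "eval I (App f es) = I f (map (eval I) es)"

text \<open>Processes up to \<open>\<alpha>\<close>-conversion are represented in locally nameless style: an occurrence of a
  name is either \<open>Free a\<close> or a de Bruijn index \<open>Bound i\<close>. Indices of higher-order names count the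
  enclosing \<open>InH\<close>, \<open>OutH\<close>, \<open>RepH\<close>, \<open>ResH\<close>; indices of first-order names count the enclosing
  \<open>ResF\<close>. The binding constructs of the calculus, with explicit bound names, are \<open>inH\<close>, \<open>outH\<close>,
  \<open>repH\<close>, \<open>nuH\<close>, \<open>nuF\<close> below. First-order variables are kept as names: only values are ever
  substituted for them, so they need no renaming.\<close>

datatype occ = Free nat | Bound nat

datatype ('f, 'v) proc =
    InH occ var "('f, 'v) proc"
  | InF occ var "('f, 'v) proc"
  | OutH occ "('f, 'v) expr" "('f, 'v) proc"
  | OutF occ "('f, 'v) expr" "('f, 'v) proc"
  | Succ sname "('f, 'v) proc"
  | RepH occ var "('f, 'v) proc"
  | RepF occ var "('f, 'v) proc"
  | Par "('f, 'v) proc" "('f, 'v) proc"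
  | ResH "('f, 'v) proc"
  | ResF "('f, 'v) proc"
  | Null
  | Sum "('f, 'v) proc" "('f, 'v) proc"
  | IfEq "('f, 'v) expr" "('f, 'v) expr" "('f, 'v) proc" "('f, 'v) proc"

text \<open>Abstracting a free name makes room for the new index by shifting the dangling ones, so that
  \<open>closeH 0 b\<close> is injective on all terms.\<close>

definition close_occ :: "nat \<Rightarrow> nat \<Rightarrow> occ \<Rightarrow> occ" where
  "close_occ k b u = (case u of
      Free a \<Rightarrow> (if a = b then Bound k else Free a)
    | Bound i \<Rightarrow> (if i < k then Bound i else Bound (Suc i)))"

primrec closeH :: "nat \<Rightarrow> hname \<Rightarrow> ('f, 'v) proc \<Rightarrow> ('f, 'v) proc" where
  "closeH k b (InH u x P) = InH (close_occ k b u) x (closeH (Suc k) b P)"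
| "closeH k b (InF u x P) = InF u x (closeH k b P)"
| "closeH k b (OutH u e P) = OutH (close_occ k b u) e (closeH (Suc k) b P)"
| "closeH k b (OutF u e P) = OutF u e (closeH k b P)"
| "closeH k b (Succ w P) = Succ w (closeH k b P)"
| "closeH k b (RepH u x P) = RepH (close_occ k b u) x (closeH (Suc k) b P)"
| "closeH k b (RepF u x P) = RepF u x (closeH k b P)"
| "closeH k b (Par P Q) = Par (closeH k b P) (closeH k b Q)"
| "closeH k b (ResH P) = ResH (closeH (Suc k) b P)"
| "closeH k b (ResF P) = ResF (closeH k b P)"
| "closeH k b Null = Null"
| "closeH k b (Sum P Q) = Sum (closeH k b P) (closeH k b Q)"
| "closeH k b (IfEq e f P Q) = IfEq e f (closeH k b P) (closeH k b Q)"

primrec closeF :: "nat \<Rightarrow> fname \<Rightarrow> ('f, 'v) proc \<Rightarrow> ('f, 'v) proc" where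
  "closeF k h (InH u x P) = InH u x (closeF k h P)"
| "closeF k h (InF u x P) = InF (close_occ k h u) x (closeF k h P)"
| "closeF k h (OutH u e P) = OutH u e (closeF k h P)"
| "closeF k h (OutF u e P) = OutF (close_occ k h u) e (closeF k h P)"
| "closeF k h (Succ w P) = Succ w (closeF k h P)"
| "closeF k h (RepH u x P) = RepH u x (closeF k h P)"
| "closeF k h (RepF u x P) = RepF (close_occ k h u) x (closeF k h P)"
| "closeF k h (Par P Q) = Par (closeF k h P) (closeF k h Q)"
| "closeF k h (ResH P) = ResH (closeF k h P)"
| "closeF k h (ResF P) = ResF (closeF (Suc k) h P)"
| "closeF k h Null = Null"
| "closeF k h (Sum P Q) = Sum (closeF k h P) (closeF k h Q)"
| "closeF k h (IfEq e f P Q) = IfEq e f (closeF k h P) (closeF k h Q)"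

text \<open>\<open>a(x,b).P\<close>, \<open>!a(x,b).P\<close>, the output on \<open>a\<close> of \<open>e\<close> with the fresh name \<open>b\<close>, and the two
  restrictions.\<close>

definition inH :: "hname \<Rightarrow> var \<Rightarrow> hname \<Rightarrow> ('f, 'v) proc \<Rightarrow> ('f, 'v) proc" where
  "inH a x b P = InH (Free a) x (closeH 0 b P)"

definition repH :: "hname \<Rightarrow> var \<Rightarrow> hname \<Rightarrow> ('f, 'v) proc \<Rightarrow> ('f, 'v) proc" where
  "repH a x b P = RepH (Free a) x (closeH 0 b P)"

definition outH :: "hname \<Rightarrow> ('f, 'v) expr \<Rightarrow> hname \<Rightarrow> ('f, 'v) proc \<Rightarrow> ('f, 'v) proc" where
  "outH a e b P = OutH (Free a) e (closeH 0 b P)"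

definition nuH :: "hname \<Rightarrow> ('f, 'v) proc \<Rightarrow> ('f, 'v) proc" where
  "nuH a P = ResH (closeH 0 a P)"

definition nuF :: "fname \<Rightarrow> ('f, 'v) proc \<Rightarrow> ('f, 'v) proc" where
  "nuF h P = ResF (closeF 0 h P)"

primrec occ_names :: "occ \<Rightarrow> nat set" where
  "occ_names (Free a) = {a}"
| "occ_names (Bound i) = {}"

text \<open>Free higher-order names.\<close>

primrec fhn :: "('f, 'v) proc \<Rightarrow> hname set" where
  "fhn (InH u x P) = occ_names u \<union> fhn P"
| "fhn (InF u x P) = fhn P"
| "fhn (OutH u e P) = occ_names u \<union> fhn P"
| "fhn (OutF u e P) = fhn P"
| "fhn (Succ w P) = fhn P"
| "fhn (RepH u x P) = occ_names u \<union> fhn P"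
| "fhn (RepF u x P) = fhn P"
| "fhn (Par P Q) = fhn P \<union> fhn Q"
| "fhn (ResH P) = fhn P"
| "fhn (ResF P) = fhn P"
| "fhn Null = {}"
| "fhn (Sum P Q) = fhn P \<union> fhn Q"
| "fhn (IfEq e f P Q) = fhn P \<union> fhn Q"

primrec snames :: "('f, 'v) proc \<Rightarrow> sname set" where
  "snames (InH u x P) = snames P"
| "snames (InF u x P) = snames P"
| "snames (OutH u e P) = snames P"
| "snames (OutF u e P) = snames P"
| "snames (Succ w P) = insert w (snames P)"
| "snames (RepH u x P) = snames P"
| "snames (RepF u x P) = snames P"
| "snames (Par P Q) = snames P \<union> snames Q"
| "snames (ResH P) = snames P"
| "snames (ResF P) = snames P"
| "snames Null = {}"
| "snames (Sum P Q) = snames P \<union> snames Q"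
| "snames (IfEq e f P Q) = snames P \<union> snames Q"

primrec psubst :: "var \<Rightarrow> 'v \<Rightarrow> ('f, 'v) proc \<Rightarrow> ('f, 'v) proc" where
  "psubst x v (InH u y P) = InH u y (if y = x then P else psubst x v P)"
| "psubst x v (InF u y P) = InF u y (if y = x then P else psubst x v P)"
| "psubst x v (OutH u e P) = OutH u (esubst x v e) (psubst x v P)"
| "psubst x v (OutF u e P) = OutF u (esubst x v e) (psubst x v P)"
| "psubst x v (Succ w P) = Succ w (psubst x v P)"
| "psubst x v (RepH u y P) = RepH u y (if y = x then P else psubst x v P)"
| "psubst x v (RepF u y P) = RepF u y (if y = x then P else psubst x v P)"
| "psubst x v (Par P Q) = Par (psubst x v P) (psubst x v Q)"
| "psubst x v (ResH P) = ResH (psubst x v P)"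
| "psubst x v (ResF P) = ResF (psubst x v P)"
| "psubst x v Null = Null"
| "psubst x v (Sum P Q) = Sum (psubst x v P) (psubst x v Q)"
| "psubst x v (IfEq e f P Q) = IfEq (esubst x v e) (esubst x v f) (psubst x v P) (psubst x v Q)"

text \<open>\<open>closed_at i j X P\<close>: all higher-order indices of \<open>P\<close> point to one of its binders or to one of
  \<open>i\<close> further ones, similarly for first-order names and \<open>j\<close>, and the free variables of \<open>P\<close> are in
  \<open>X\<close>.\<close>

primrec occ_below :: "nat \<Rightarrow> occ \<Rightarrow> bool" where
  "occ_below k (Free a) \<longleftrightarrow> True"
| "occ_below k (Bound i) \<longleftrightarrow> i < k"

primrec closed_at :: "nat \<Rightarrow> nat \<Rightarrow> var set \<Rightarrow> ('f, 'v) proc \<Rightarrow> bool" where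
  "closed_at i j X (InH u x P) \<longleftrightarrow> occ_below i u \<and> closed_at (Suc i) j (insert x X) P"
| "closed_at i j X (InF u x P) \<longleftrightarrow> occ_below j u \<and> closed_at i j (insert x X) P"
| "closed_at i j X (OutH u e P) \<longleftrightarrow> occ_below i u \<and> evars e \<subseteq> X \<and> closed_at (Suc i) j X P"
| "closed_at i j X (OutF u e P) \<longleftrightarrow> occ_below j u \<and> evars e \<subseteq> X \<and> closed_at i j X P"
| "closed_at i j X (Succ w P) \<longleftrightarrow> closed_at i j X P"
| "closed_at i j X (RepH u x P) \<longleftrightarrow> occ_below i u \<and> closed_at (Suc i) j (insert x X) P"
| "closed_at i j X (RepF u x P) \<longleftrightarrow> occ_below j u \<and> closed_at i j (insert x X) P"
| "closed_at i j X (Par P Q) \<longleftrightarrow> closed_at i j X P \<and> closed_at i j X Q"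
| "closed_at i j X (ResH P) \<longleftrightarrow> closed_at (Suc i) j X P"
| "closed_at i j X (ResF P) \<longleftrightarrow> closed_at i (Suc j) X P"
| "closed_at i j X Null \<longleftrightarrow> True"
| "closed_at i j X (Sum P Q) \<longleftrightarrow> closed_at i j X P \<and> closed_at i j X Q"
| "closed_at i j X (IfEq e f P Q) \<longleftrightarrow>
     evars e \<subseteq> X \<and> evars f \<subseteq> X \<and> closed_at i j X P \<and> closed_at i j X Q"

definition closed_proc :: "('f, 'v) proc \<Rightarrow> bool" where
  "closed_proc P \<longleftrightarrow> closed_at 0 0 {} P"


section \<open>Transitions\<close>

datatype 'v action =
    Tau
  | AInH hname 'v hname   \<comment> \<open>\<open>AInH a v b\<close>: input on \<open>a\<close> of \<open>v\<close> and the bound name \<open>b\<close>\<close>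
  | AOutH hname 'v hname
  | AInF fname 'v
  | AOutF fname 'v
  | ASucc sname

primrec act_fhn :: "'v action \<Rightarrow> hname set" where
  "act_fhn Tau = {}"
| "act_fhn (AInH a v b) = {a}"
| "act_fhn (AOutH a v b) = {a}"
| "act_fhn (AInF h v) = {}"
| "act_fhn (AOutF h v) = {}"
| "act_fhn (ASucc w) = {}"

primrec act_bhn :: "'v action \<Rightarrow> hname list" where
  "act_bhn Tau = []"
| "act_bhn (AInH a v b) = [b]"
| "act_bhn (AOutH a v b) = [b]"
| "act_bhn (AInF h v) = []"
| "act_bhn (AOutF h v) = []"
| "act_bhn (ASucc w) = []"

primrec act_ffn :: "'v action \<Rightarrow> fname set" where
  "act_ffn Tau = {}"
| "act_ffn (AInH a v b) = {}"
| "act_ffn (AOutH a v b) = {}"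
| "act_ffn (AInF h v) = {h}"
| "act_ffn (AOutF h v) = {h}"
| "act_ffn (ASucc w) = {}"

text \<open>The usual convention that bound names are distinct from all other names is made explicit: the
  bound name of an action differs from its subject, and a restricted name does not occur in the
  action at all. Without it a replicated input or a restriction could capture the bound name.\<close>

inductive step ::
  "('f \<Rightarrow> 'v list \<Rightarrow> 'v) \<Rightarrow> ('f, 'v) proc \<Rightarrow> 'v action \<Rightarrow> ('f, 'v) proc \<Rightarrow> bool"
  for I :: "'f \<Rightarrow> 'v list \<Rightarrow> 'v"
where
  step_inH: "b \<noteq> a \<Longrightarrow> step I (inH a x b P) (AInH a v b) (psubst x v P)"
| step_outH: "b \<noteq> a \<Longrightarrow> eval I e = v \<Longrightarrow> step I (outH a e b P) (AOutH a v b) P"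
| step_inF: "step I (InF (Free h) x P) (AInF h v) (psubst x v P)"
| step_outF: "eval I e = v \<Longrightarrow> step I (OutF (Free h) e P) (AOutF h v) P"
| step_succ: "step I (Succ w P) (ASucc w) Null"
| step_repH: "step I (inH a x b P) \<mu> Q \<Longrightarrow> step I (repH a x b P) \<mu> (Par Q (repH a x b P))"
| step_repF: "step I (InF (Free h) x P) \<mu> Q \<Longrightarrow>
    step I (RepF (Free h) x P) \<mu> (Par Q (RepF (Free h) x P))"
| step_nuH: "step I P \<mu> P' \<Longrightarrow> n \<notin> act_fhn \<mu> \<Longrightarrow> n \<notin> set (act_bhn \<mu>) \<Longrightarrow>
    step I (nuH n P) \<mu> (nuH n P')"
| step_nuF: "step I P \<mu> P' \<Longrightarrow> h \<notin> act_ffn \<mu> \<Longrightarrow> step I (nuF h P) \<mu> (nuF h P')"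
| step_sum1: "step I P \<mu> P' \<Longrightarrow> step I (Sum P Q) \<mu> P'"
| step_sum2: "step I Q \<mu> Q' \<Longrightarrow> step I (Sum P Q) \<mu> Q'"
| step_commH1: "step I P (AInH a v b) P' \<Longrightarrow> step I Q (AOutH a v b) Q' \<Longrightarrow>
    step I (Par P Q) Tau (nuH b (Par P' Q'))"
| step_commH2: "step I P (AOutH a v b) P' \<Longrightarrow> step I Q (AInH a v b) Q' \<Longrightarrow>
    step I (Par P Q) Tau (nuH b (Par P' Q'))"
| step_commF1: "step I P (AInF h v) P' \<Longrightarrow> step I Q (AOutF h v) Q' \<Longrightarrow>
    step I (Par P Q) Tau (Par P' Q')"
| step_commF2: "step I P (AOutF h v) P' \<Longrightarrow> step I Q (AInF h v) Q' \<Longrightarrow>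
    step I (Par P Q) Tau (Par P' Q')"
| step_par1: "step I P \<mu> P' \<Longrightarrow> set (act_bhn \<mu>) \<inter> fhn Q = {} \<Longrightarrow> step I (Par P Q) \<mu> (Par P' Q)"
| step_par2: "step I Q \<mu> Q' \<Longrightarrow> set (act_bhn \<mu>) \<inter> fhn P = {} \<Longrightarrow> step I (Par P Q) \<mu> (Par P Q')"
| step_if_true: "eval I e = eval I f \<Longrightarrow> step I P \<mu> P' \<Longrightarrow> step I (IfEq e f P Q) \<mu> P'"
| step_if_false: "eval I e \<noteq> eval I f \<Longrightarrow> step I Q \<mu> Q' \<Longrightarrow> step I (IfEq e f P Q) \<mu> Q'"

definition may_succeed :: "('f \<Rightarrow> 'v list \<Rightarrow> 'v) \<Rightarrow> ('f, 'v) proc \<Rightarrow> sname \<Rightarrow> bool" where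
  "may_succeed I P w \<longleftrightarrow> (\<exists>P' P''. (\<lambda>R R'. step I R Tau R')\<^sup>*\<^sup>* P P' \<and> step I P' (ASucc w) P'')"


section \<open>Visibility functions and typing\<close>

datatype tok = Cur | Nm hname

type_synonym vis = "tok \<rightharpoonup> hname set"

definition vget :: "vis \<Rightarrow> tok \<Rightarrow> hname set" where
  "vget \<Delta> p = (case \<Delta> p of None \<Rightarrow> {} | Some V \<Rightarrow> V)"

definition visibility :: "vis \<Rightarrow> bool" where
  "visibility \<Delta> \<longleftrightarrow> finite (dom \<Delta>) \<and> (\<forall>V \<in> ran \<Delta>. finite V) \<and>
     (\<forall>p \<in> dom \<Delta>. \<forall>a. Nm a \<in> dom \<Delta> \<longrightarrow> a \<in> vget \<Delta> p \<longrightarrow> vget \<Delta> (Nm a) \<subseteq> vget \<Delta> p)"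

definition vnames :: "vis \<Rightarrow> hname set" where
  "vnames \<Delta> = {a. Nm a \<in> dom \<Delta>} \<union> \<Union> (ran \<Delta>)"

definition verase :: "vis \<Rightarrow> tok \<Rightarrow> vis" where
  "verase \<Delta> p = (\<lambda>q. if q = p then None else map_option (\<lambda>V. V - {a. Nm a = p}) (\<Delta> q))"

definition vunion :: "vis \<Rightarrow> vis \<Rightarrow> vis" where
  "vunion \<Delta>\<^sub>1 \<Delta>\<^sub>2 =
     (\<lambda>p. if p \<in> dom \<Delta>\<^sub>1 \<union> dom \<Delta>\<^sub>2 then Some (vget \<Delta>\<^sub>1 p \<union> vget \<Delta>\<^sub>2 p) else None)"

definition compatible :: "vis \<Rightarrow> vis \<Rightarrow> bool" where
  "compatible \<Delta>\<^sub>1 \<Delta>\<^sub>2 \<longleftrightarrow> Cur \<notin> dom \<Delta>\<^sub>1 \<inter> dom \<Delta>\<^sub>2"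

definition vsplit :: "vis \<Rightarrow> (vis \<times> vis) set" where
  "vsplit \<Delta> = {(\<Delta>\<^sub>1, \<Delta>\<^sub>2). visibility \<Delta>\<^sub>1 \<and> visibility \<Delta>\<^sub>2 \<and>
     vunion \<Delta>\<^sub>1 \<Delta>\<^sub>2 = \<Delta> \<and> Cur \<notin> dom \<Delta>\<^sub>1 \<inter> dom \<Delta>\<^sub>2}"

text \<open>The premises \<open>visibility \<Delta>\<close> restrict the judgement to visibility functions. Bound names are
  chosen fresh for \<open>\<Delta>\<close>, not just outside its domain.\<close>

inductive typed :: "vis \<Rightarrow> ('f, 'v) proc \<Rightarrow> bool" (infix \<open>\<turnstile>\<close> 50) where
  typed_outH: "visibility \<Delta> \<Longrightarrow> a \<in> vget \<Delta> Cur \<Longrightarrow> b \<notin> vnames \<Delta> \<Longrightarrow>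
    (verase \<Delta> Cur)(Nm b \<mapsto> vget \<Delta> Cur \<union> {b}) \<turnstile> P \<Longrightarrow> \<Delta> \<turnstile> outH a e b P"
| typed_inH: "visibility \<Delta> \<Longrightarrow> Cur \<notin> dom \<Delta> \<Longrightarrow> Nm a \<in> dom \<Delta> \<Longrightarrow> b \<notin> vnames \<Delta> \<Longrightarrow>
    \<Delta>(Cur \<mapsto> vget \<Delta> (Nm a) \<union> {b}) \<turnstile> P \<Longrightarrow> \<Delta> \<turnstile> inH a x b P"
| typed_outF: "\<Delta> \<turnstile> P \<Longrightarrow> Cur \<notin> dom \<Delta> \<Longrightarrow> \<Delta> \<turnstile> OutF (Free h) e P"
| typed_inF: "\<Delta> \<turnstile> P \<Longrightarrow> Cur \<in> dom \<Delta> \<Longrightarrow> \<Delta> \<turnstile> InF (Free h) x P"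
| typed_repH: "\<Delta> \<turnstile> inH a x b P \<Longrightarrow> Cur \<notin> dom \<Delta> \<Longrightarrow> \<Delta> \<turnstile> repH a x b P"
| typed_repF: "\<Delta> \<turnstile> InF (Free h) x P \<Longrightarrow> Cur \<notin> dom \<Delta> \<Longrightarrow> \<Delta> \<turnstile> RepF (Free h) x P"
| typed_succ: "visibility \<Delta> \<Longrightarrow> \<Delta> \<turnstile> Succ w P"
| typed_nuH: "\<Delta> \<turnstile> P \<Longrightarrow> verase \<Delta> (Nm a) \<turnstile> nuH a P"
| typed_nuF: "\<Delta> \<turnstile> P \<Longrightarrow> \<Delta> \<turnstile> nuF h P"
| typed_null: "visibility \<Delta> \<Longrightarrow> Cur \<notin> dom \<Delta> \<Longrightarrow> \<Delta> \<turnstile> Null"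
| typed_sum: "\<Delta> \<turnstile> P\<^sub>1 \<Longrightarrow> \<Delta> \<turnstile> P\<^sub>2 \<Longrightarrow> \<Delta> \<turnstile> Sum P\<^sub>1 P\<^sub>2"
| typed_if: "\<Delta> \<turnstile> P\<^sub>1 \<Longrightarrow> \<Delta> \<turnstile> P\<^sub>2 \<Longrightarrow> \<Delta> \<turnstile> IfEq e f P\<^sub>1 P\<^sub>2"
| typed_par: "visibility \<Delta> \<Longrightarrow> (\<Delta>\<^sub>1, \<Delta>\<^sub>2) \<in> vsplit \<Delta> \<Longrightarrow> \<Delta>\<^sub>1 \<turnstile> P\<^sub>1 \<Longrightarrow> \<Delta>\<^sub>2 \<turnstile> P\<^sub>2 \<Longrightarrow>
    \<Delta> \<turnstile> Par P\<^sub>1 P\<^sub>2"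


section \<open>May testing\<close>

text \<open>Success names are the tester's means to signal success; \<open>w\<close> therefore ranges over the success
  names not occurring in the tested processes. If \<open>P\<close> and \<open>Q\<close> contain no success name at all, this
  is no restriction. It cannot be dropped otherwise: success actions are not type-allowed
  transitions, so \<open>Succ w Null\<close> and \<open>Null\<close> have the same traces.\<close>

definition may_equiv ::
  "('f \<Rightarrow> 'v list \<Rightarrow> 'v) \<Rightarrow> vis \<Rightarrow> vis \<Rightarrow> ('f, 'v) proc \<Rightarrow> ('f, 'v) proc \<Rightarrow> bool" where
  "may_equiv I \<Delta> \<Gamma> P Q \<longleftrightarrow> compatible \<Delta> \<Gamma> \<and> \<Delta> \<turnstile> P \<and> \<Delta> \<turnstile> Q \<and>
     (\<forall>R w. closed_proc R \<longrightarrow> \<Gamma> \<turnstile> R \<longrightarrow> w \<notin> snames P \<union> snames Q \<longrightarrow>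
        (may_succeed I (Par R P) w \<longleftrightarrow> may_succeed I (Par R Q) w))"


section \<open>Type-allowed transitions and traces\<close>

inductive tstep ::
  "('f \<Rightarrow> 'v list \<Rightarrow> 'v) \<Rightarrow> vis \<Rightarrow> ('f, 'v) proc \<Rightarrow> 'v action \<Rightarrow> vis \<Rightarrow> ('f, 'v) proc \<Rightarrow> bool"
  for I :: "'f \<Rightarrow> 'v list \<Rightarrow> 'v"
where
  tstep_outH: "step I P (AOutH a v b) P' \<Longrightarrow> Nm a \<in> dom \<Gamma> \<Longrightarrow> Cur \<notin> dom \<Gamma> \<Longrightarrow> b \<notin> vnames \<Gamma> \<Longrightarrow>
    tstep I \<Gamma> P (AOutH a v b) (\<Gamma>(Cur \<mapsto> vget \<Gamma> (Nm a) \<union> {b})) P'"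
| tstep_inH: "step I P (AInH a v b) P' \<Longrightarrow> a \<in> vget \<Gamma> Cur \<Longrightarrow> b \<notin> vnames \<Gamma> \<Longrightarrow>
    tstep I \<Gamma> P (AInH a v b) ((verase \<Gamma> Cur)(Nm b \<mapsto> vget \<Gamma> Cur \<union> {b})) P'"
| tstep_outF: "step I P (AOutF h v) P' \<Longrightarrow> Cur \<in> dom \<Gamma> \<Longrightarrow> tstep I \<Gamma> P (AOutF h v) \<Gamma> P'"
| tstep_inF: "step I P (AInF h v) P' \<Longrightarrow> Cur \<notin> dom \<Gamma> \<Longrightarrow> tstep I \<Gamma> P (AInF h v) \<Gamma> P'"
| tstep_tau: "step I P Tau P' \<Longrightarrow> Cur \<notin> dom \<Gamma> \<Longrightarrow> tstep I \<Gamma> P Tau \<Gamma> P'"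

definition tweak :: "('f \<Rightarrow> 'v list \<Rightarrow> 'v) \<Rightarrow> vis \<Rightarrow> ('f, 'v) proc \<Rightarrow> ('f, 'v) proc \<Rightarrow> bool" where
  "tweak I \<Gamma> = (\<lambda>P P'. tstep I \<Gamma> P Tau \<Gamma> P')\<^sup>*\<^sup>*"

definition tweak_step ::
  "('f \<Rightarrow> 'v list \<Rightarrow> 'v) \<Rightarrow> vis \<Rightarrow> ('f, 'v) proc \<Rightarrow> 'v action \<Rightarrow> vis \<Rightarrow> ('f, 'v) proc \<Rightarrow> bool"
where
  "tweak_step I \<Gamma> P \<mu> \<Gamma>' P' \<longleftrightarrow>
     (\<exists>P'' P'''. tweak I \<Gamma> P P'' \<and> tstep I \<Gamma> P'' \<mu> \<Gamma>' P''' \<and> tweak I \<Gamma>' P''' P')"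

inductive tweak_steps ::
  "('f \<Rightarrow> 'v list \<Rightarrow> 'v) \<Rightarrow> vis \<Rightarrow> ('f, 'v) proc \<Rightarrow> 'v action list \<Rightarrow> vis \<Rightarrow> ('f, 'v) proc \<Rightarrow> bool"
  for I :: "'f \<Rightarrow> 'v list \<Rightarrow> 'v"
where
  tweak_steps_Nil: "tweak_steps I \<Gamma> P [] \<Gamma> P"
| tweak_steps_Cons: "tweak_step I \<Gamma> P \<mu> \<Gamma>' P' \<Longrightarrow> tweak_steps I \<Gamma>' P' s \<Gamma>'' P'' \<Longrightarrow>
    tweak_steps I \<Gamma> P (\<mu> # s) \<Gamma>'' P''"

definition trace_bhn :: "'v action list \<Rightarrow> hname list" where
  "trace_bhn s = concat (map act_bhn s)"

text \<open>The bound name of an action also binds its occurrences in the rest of the trace.\<close>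

primrec trace_fhn :: "'v action list \<Rightarrow> hname set" where
  "trace_fhn [] = {}"
| "trace_fhn (\<mu> # s) = act_fhn \<mu> \<union> (trace_fhn s - set (act_bhn \<mu>))"

definition is_trace :: "'v action list \<Rightarrow> bool" where
  "is_trace s \<longleftrightarrow> Tau \<notin> set s \<and> distinct (trace_bhn s) \<and> set (trace_bhn s) \<inter> trace_fhn s = {}"

definition trace_of :: "('f \<Rightarrow> 'v list \<Rightarrow> 'v) \<Rightarrow> vis \<Rightarrow> ('f, 'v) proc \<Rightarrow> 'v action list \<Rightarrow> bool" where
  "trace_of I \<Gamma> P s \<longleftrightarrow> is_trace s \<and> (\<exists>\<Gamma>' P'. tweak_steps I \<Gamma> P s \<Gamma>' P')"

text \<open>Traces are compared on bound names fresh for everything in sight. Otherwise, a name that is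
  free in \<open>P\<close> but not in \<open>Q\<close> could be the bound name in a trace of \<open>Q\<close> but, by the side condition on
  parallel composition, not in the corresponding trace of \<open>P\<close>.\<close>

definition trace_equiv ::
  "('f \<Rightarrow> 'v list \<Rightarrow> 'v) \<Rightarrow> vis \<Rightarrow> vis \<Rightarrow> ('f, 'v) proc \<Rightarrow> ('f, 'v) proc \<Rightarrow> bool" where
  "trace_equiv I \<Delta> \<Gamma> P Q \<longleftrightarrow> compatible \<Delta> \<Gamma> \<and> \<Delta> \<turnstile> P \<and> \<Delta> \<turnstile> Q \<and>
     (\<forall>s. set (trace_bhn s) \<inter> (fhn P \<union> fhn Q \<union> vnames \<Delta> \<union> vnames \<Gamma>) = {} \<longrightarrow>
        (trace_of I \<Gamma> P s \<longleftrightarrow> trace_of I \<Gamma> Q s))"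

end

theory Submission
  imports Defs "HOL-Combinatorics.Transposition"
begin

text \<open>
  A computation of \<open>R | P\<close> leading to a success of \<open>R\<close> splits into a sequence of actions of \<open>P\<close> and
  the complementary actions of \<open>R\<close>. Since \<open>R\<close> is typed by \<open>\<Gamma>\<close>, it can only offer complements of
  actions that \<open>\<Gamma>\<close> allows, and since \<open>P\<close> moves internally only while it holds the control token,
  its internal steps are allowed as well. So \<open>P\<close> performs a trace under \<open>\<Gamma>\<close>. If \<open>Q\<close> has the same
  trace, it can be run against the same actions of \<open>R\<close>. Bound names can be chosen fresh in this
  process, because communications restrict them.

  Conversely, every trace \<open>s\<close> under \<open>\<Gamma>\<close> has a sequential tester, typed by \<open>\<Gamma>\<close>, which performs the
  complement of \<open>s\<close>, compares the received values with those in \<open>s\<close>, and then signals success. The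
  visibility function of the tester evolves exactly as prescribed by the type-allowed transitions,
  and a process succeeds with this tester only if it has the trace \<open>s\<close>.
\<close>

section \<open>Renaming of higher-order names\<close>

text \<open>Bound names are explicit in the rules but only abstractions in the terms, so a
  derivation may use any representative. Names are therefore exchanged by transpositions, which are
  injective and self-inverse, and several facts about transitions are first shown for bound names
  outside some finite set; this suffices, as a communication can always be moved to a fresh name.
  The two sides of a test are treated differently. Type-allowed transitions follow the visibility of
  the observer, so the tester needs a typing that survives its steps. \<open>typed\<close> has no
  weakening rule and its splits use up the visibility function exactly, whereas after a
  communication the receiver sees only what the sender's subject gives access to; hence the relaxed
  relation \<open>wt\<close>. Of the tested process it is enough to know whether it holds
  \<open>Cur\<close>: this decides when it can move internally or output a name, and hence which
  actions of it are allowed.\<close>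

primrec ren_occ :: "(nat \<Rightarrow> nat) \<Rightarrow> occ \<Rightarrow> occ" where
  "ren_occ f (Free a) = Free (f a)"
| "ren_occ f (Bound i) = Bound i"

primrec ren :: "(hname \<Rightarrow> hname) \<Rightarrow> ('f, 'v) proc \<Rightarrow> ('f, 'v) proc" where
  "ren f (InH u x P) = InH (ren_occ f u) x (ren f P)"
| "ren f (InF u x P) = InF u x (ren f P)"
| "ren f (OutH u e P) = OutH (ren_occ f u) e (ren f P)"
| "ren f (OutF u e P) = OutF u e (ren f P)"
| "ren f (Succ w P) = Succ w (ren f P)"
| "ren f (RepH u x P) = RepH (ren_occ f u) x (ren f P)"
| "ren f (RepF u x P) = RepF u x (ren f P)"
| "ren f (Par P Q) = Par (ren f P) (ren f Q)"
| "ren f (ResH P) = ResH (ren f P)"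
| "ren f (ResF P) = ResF (ren f P)"
| "ren f Null = Null"
| "ren f (Sum P Q) = Sum (ren f P) (ren f Q)"
| "ren f (IfEq e g P Q) = IfEq e g (ren f P) (ren f Q)"

primrec act_ren :: "(hname \<Rightarrow> hname) \<Rightarrow> 'v action \<Rightarrow> 'v action" where
  "act_ren f Tau = Tau"
| "act_ren f (AInH a v b) = AInH (f a) v (f b)"
| "act_ren f (AOutH a v b) = AOutH (f a) v (f b)"
| "act_ren f (AInF h v) = AInF h v"
| "act_ren f (AOutF h v) = AOutF h v"
| "act_ren f (ASucc w) = ASucc w"

lemma ren_occ_idem: "(\<And>a. a \<in> occ_names u \<Longrightarrow> f a = a) \<Longrightarrow> ren_occ f u = u"
  by (cases u) auto

lemma ren_idem: "(\<And>a. a \<in> fhn P \<Longrightarrow> f a = a) \<Longrightarrow> ren f P = P"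
  by (induction P) (auto intro: ren_occ_idem)

lemma ren_transpose_fresh: "a \<notin> fhn P \<Longrightarrow> b \<notin> fhn P \<Longrightarrow> ren (transpose a b) P = P"
  by (rule ren_idem) (metis transpose_apply_other)

lemma ren_comp: "ren f (ren g P) = ren (f \<circ> g) P"
proof -
  have "ren_occ f (ren_occ g u) = ren_occ (f \<circ> g) u" for u by (cases u) auto
  then show ?thesis by (induction P) auto
qed

lemma ren_cong: "(\<And>a. a \<in> fhn P \<Longrightarrow> f a = g a) \<Longrightarrow> ren f P = ren g P"
proof -
  have "(\<And>a. a \<in> occ_names u \<Longrightarrow> f a = g a) \<Longrightarrow> ren_occ f u = ren_occ g u" for u
    by (cases u) auto
  then show "(\<And>a. a \<in> fhn P \<Longrightarrow> f a = g a) \<Longrightarrow> ren f P = ren g P"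
    by (induction P) auto
qed

lemma finite_fhn [simp]: "finite (fhn P)"
proof -
  have "finite (occ_names u)" for u by (cases u) auto
  then show ?thesis by (induction P) auto
qed

lemma finite_snames [simp]: "finite (snames P)"
  by (induction P) auto

lemma occ_names_close_occ [simp]: "occ_names (close_occ k b u) = occ_names u - {b}"
  by (cases u) (auto simp: close_occ_def)

lemma fhn_closeH [simp]: "fhn (closeH k b P) = fhn P - {b}"
  by (induction P arbitrary: k) auto

lemma fhn_closeF [simp]: "fhn (closeF k h P) = fhn P"
  by (induction P arbitrary: k) auto

lemma fhn_psubst [simp]: "fhn (psubst x v P) = fhn P"
  by (induction P) auto

lemma fhn_ren [simp]: "fhn (ren f P) = f ` fhn P"
proof -
  have "occ_names (ren_occ f u) = f ` occ_names u" for u by (cases u) auto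
  then show ?thesis by (induction P) auto
qed

lemma snames_closeH [simp]: "snames (closeH k b P) = snames P"
  by (induction P arbitrary: k) auto

lemma snames_closeF [simp]: "snames (closeF k h P) = snames P"
  by (induction P arbitrary: k) auto

lemma snames_psubst [simp]: "snames (psubst x v P) = snames P"
  by (induction P) auto

lemma psubst_closeH: "psubst x v (closeH k b P) = closeH k b (psubst x v P)"
  by (induction P arbitrary: k) auto

lemma psubst_ren: "psubst x v (ren f P) = ren f (psubst x v P)"
  by (induction P) auto

lemma ren_closeF: "ren f (closeF k h P) = closeF k h (ren f P)"
  by (induction P arbitrary: k) auto

lemma ren_closeH: "inj f \<Longrightarrow> ren f (closeH k b P) = closeH k (f b) (ren f P)"
proof (induction P arbitrary: k)
qed (auto simp: close_occ_def inj_eq split: occ.splits)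

lemma closeH_inject [simp]: "closeH k b P = closeH k b Q \<longleftrightarrow> P = Q"
proof -
  have *: "close_occ k b u = close_occ k b u' \<longleftrightarrow> u = u'" for k u u'
    by (auto simp: close_occ_def split: occ.splits if_splits)
  show ?thesis
  proof (induction P arbitrary: k Q)
  qed (case_tac Q; simp add: *)+
qed

text \<open>Alpha-conversion: as \<open>b'\<close> does not occur, the swap merely replaces
  \<open>b\<close> by \<open>b'\<close>, and abstraction turns either into the same index. A swap is
  preferred to a substitution because injective renamings commute with
  \<open>closeH\<close>.\<close>

lemma closeH_alpha:
  assumes "b' \<notin> fhn P \<or> b' = b"
  shows "closeH k b' (ren (transpose b b') P) = closeH k b P"
proof -
  have *: "close_occ k b' (ren_occ (transpose b b') u) = close_occ k b u"
    if "b' \<notin> occ_names u \<or> b' = b" for k u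
    using that by (cases u) (auto simp: close_occ_def transpose_def)
  show ?thesis using assms
    by (induction P arbitrary: k) (auto simp: * ren_occ_idem)
qed

text \<open>Converse of \<open>closeH_alpha\<close>, by rewriting the right-hand side to the bound
  name \<open>b\<close> and cancelling the injective \<open>closeH k b\<close>. All inversions of
  rules with an explicit bound name rest on it.\<close>

lemma closeH_eqD:
  assumes "closeH k b P = closeH k n Q"
  shows "P = ren (transpose n b) Q" and "b \<notin> fhn Q \<or> b = n"
proof -
  have "fhn P - {b} = fhn Q - {n}" using assms by (metis fhn_closeH)
  then show fr: "b \<notin> fhn Q \<or> b = n" by auto
  have "closeH k b P = closeH k b (ren (transpose n b) Q)"
    using closeH_alpha[OF fr] assms by simp
  then show "P = ren (transpose n b) Q" by simp
qed

lemma inH_alpha: "b' \<notin> fhn P \<or> b' = b \<Longrightarrow> inH a x b' (ren (transpose b b') P) = inH a x b P"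
  and outH_alpha: "b' \<notin> fhn P \<or> b' = b \<Longrightarrow> outH a e b' (ren (transpose b b') P) = outH a e b P"
  and nuH_alpha: "b' \<notin> fhn P \<or> b' = b \<Longrightarrow> nuH b' (ren (transpose b b') P) = nuH b P"
  by (simp_all add: inH_def outH_def nuH_def closeH_alpha)

lemma ren_binders:
  assumes "inj f"
  shows "ren f (inH a x b P) = inH (f a) x (f b) (ren f P)"
    and "ren f (repH a x b P) = repH (f a) x (f b) (ren f P)"
    and "ren f (outH a e b P) = outH (f a) e (f b) (ren f P)"
    and "ren f (nuH b P) = nuH (f b) (ren f P)"
    and "ren f (nuF h P) = nuF h (ren f P)"
  using assms by (simp_all add: inH_def repH_def outH_def nuH_def nuF_def ren_closeH ren_closeF)

lemma fhn_binders [simp]: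
  "fhn (inH a x b P) = insert a (fhn P - {b})"
  "fhn (repH a x b P) = insert a (fhn P - {b})"
  "fhn (outH a e b P) = insert a (fhn P - {b})"
  "fhn (nuH b P) = fhn P - {b}"
  "fhn (nuF h P) = fhn P"
  by (simp_all add: inH_def repH_def outH_def nuH_def nuF_def)

lemma snames_binders [simp]:
  "snames (inH a x b P) = snames P"
  "snames (repH a x b P) = snames P"
  "snames (outH a e b P) = snames P"
  "snames (nuH b P) = snames P"
  "snames (nuF h P) = snames P"
  by (simp_all add: inH_def repH_def outH_def nuH_def nuF_def)

section \<open>Transitions and renaming\<close>

lemmas binder_defs = inH_def repH_def outH_def nuH_def nuF_def

text \<open>The derivation may have used any representative of the abstraction, so the action can
  carry any \<open>b'\<close> fresh for \<open>P\<close>, not only the given \<open>b\<close>; the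
  residual is swapped accordingly.\<close>

lemma step_inHE:
  assumes "step I (inH a x b P) \<mu> Q"
  obtains v b' where "\<mu> = AInH a v b'" "b' \<noteq> a" "b' \<notin> fhn P \<or> b' = b"
    "Q = psubst x v (ren (transpose b b') P)"
  using assms
proof (cases rule: step.cases)
  case (step_inH b' a' x' P' v)
  then show ?thesis using that[of v b'] closeH_eqD[of 0 b' P' b P]
    by (auto simp: binder_defs)
qed (simp_all add: binder_defs)

lemma step_outHE:
  assumes "step I (outH a e b P) \<mu> Q"
  obtains b' where "\<mu> = AOutH a (eval I e) b'" "b' \<noteq> a" "b' \<notin> fhn P \<or> b' = b"
    "Q = ren (transpose b b') P"
  using assms
proof (cases rule: step.cases)
  case (step_outH b' a' e' v)
  then show ?thesis using that[of b'] closeH_eqD[of 0 b' Q b P]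
    by (auto simp: binder_defs)
qed (simp_all add: binder_defs)

lemma step_repHE:
  assumes "step I (repH a x b P) \<mu> Q"
  obtains v b' where "\<mu> = AInH a v b'" "b' \<noteq> a" "b' \<notin> fhn P \<or> b' = b"
    "Q = Par (psubst x v (ren (transpose b b') P)) (repH a x b P)"
  using assms
proof (cases rule: step.cases)
  case (step_repH a' x' b' P' Q')
  then have "inH a' x' b' P' = inH a x b P" "repH a' x' b' P' = repH a x b P"
    by (simp_all add: binder_defs)
  with step_repH that show ?thesis
    by (auto elim: step_inHE)
qed (simp_all add: binder_defs)

lemma step_InFE:
  assumes "step I (InF u x P) \<mu> Q"
  obtains h v where "u = Free h" "\<mu> = AInF h v" "Q = psubst x v P"
  using assms by (cases rule: step.cases) (simp_all add: binder_defs)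

lemma step_OutFE:
  assumes "step I (OutF u e P) \<mu> Q"
  obtains h where "u = Free h" "\<mu> = AOutF h (eval I e)" "Q = P"
  using assms by (cases rule: step.cases) (simp_all add: binder_defs)

lemma step_SuccE:
  assumes "step I (Succ w P) \<mu> Q"
  obtains "\<mu> = ASucc w" "Q = Null"
  using assms by (cases rule: step.cases) (simp_all add: binder_defs)

lemma step_SumE:
  assumes "step I (Sum P Q) \<mu> R"
  obtains "step I P \<mu> R" | "step I Q \<mu> R"
  using assms by (cases rule: step.cases) (simp_all add: binder_defs)

lemma step_IfEqE:
  assumes "step I (IfEq e f P Q) \<mu> R"
  obtains "eval I e = eval I f" "step I P \<mu> R" | "eval I e \<noteq> eval I f" "step I Q \<mu> R"
  using assms by (cases rule: step.cases) (simp_all add: binder_defs)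

lemma step_NullE: "\<not> step I Null \<mu> R"
  by (auto simp: binder_defs elim: step.cases)

lemma step_ResFE:
  assumes "step I (ResF B) \<mu> R"
  obtains h P P' where "B = closeF 0 h P" "step I P \<mu> P'" "R = nuF h P'"
  using assms by (cases rule: step.cases) (auto simp: binder_defs)

lemma step_ParE [consumes 1, case_names commH1 commH2 commF1 commF2 par1 par2]:
  assumes "step I (Par P Q) \<mu> R"
  obtains a v b P' Q' where "\<mu> = Tau" "R = nuH b (Par P' Q')"
      "step I P (AInH a v b) P'" "step I Q (AOutH a v b) Q'"
    | a v b P' Q' where "\<mu> = Tau" "R = nuH b (Par P' Q')"
      "step I P (AOutH a v b) P'" "step I Q (AInH a v b) Q'"
    | h v P' Q' where "\<mu> = Tau" "R = Par P' Q'" "step I P (AInF h v) P'" "step I Q (AOutF h v) Q'"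
    | h v P' Q' where "\<mu> = Tau" "R = Par P' Q'" "step I P (AOutF h v) P'" "step I Q (AInF h v) Q'"
    | P' where "R = Par P' Q" "step I P \<mu> P'" "set (act_bhn \<mu>) \<inter> fhn Q = {}"
    | Q' where "R = Par P Q'" "step I Q \<mu> Q'" "set (act_bhn \<mu>) \<inter> fhn P = {}"
  using assms by (cases rule: step.cases) (simp_all add: binder_defs)

lemma step_fhn: "step I P \<mu> P' \<Longrightarrow> act_fhn \<mu> \<subseteq> fhn P \<and> fhn P' \<subseteq> fhn P \<union> set (act_bhn \<mu>)"
  by (induction rule: step.induct) auto

lemma step_snames:
  "step I P \<mu> P' \<Longrightarrow> snames P' \<subseteq> snames P \<and> (\<forall>w. \<mu> = ASucc w \<longrightarrow> w \<in> snames P)"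
  by (induction rule: step.induct) auto

lemma step_bound_neq_subject: "step I P \<mu> P' \<Longrightarrow> act_fhn \<mu> \<inter> set (act_bhn \<mu>) = {}"
  by (induction rule: step.induct) auto

lemma act_names_ren [simp]:
  "act_fhn (act_ren f \<mu>) = f ` act_fhn \<mu>"
  "set (act_bhn (act_ren f \<mu>)) = f ` set (act_bhn \<mu>)"
  "act_ffn (act_ren f \<mu>) = act_ffn \<mu>"
  by (cases \<mu>; simp)+

lemma act_ren_idem:
  "(\<And>a. a \<in> act_fhn \<mu> \<union> set (act_bhn \<mu>) \<Longrightarrow> f a = a) \<Longrightarrow> act_ren f \<mu> = \<mu>"
  by (cases \<mu>) auto

text \<open>Injectivity transports the side conditions, which demand that names differ or do not
  occur.\<close>

lemma step_ren:
  assumes "inj f"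
  shows "step I P \<mu> P' \<Longrightarrow> step I (ren f P) (act_ren f \<mu>) (ren f P')"
proof (induction rule: step.induct)
  case (step_inH b a x P v)
  then show ?case using assms by (simp add: ren_binders psubst_ren[symmetric] step.step_inH inj_eq)
next
  case (step_outH b a e v P)
  then show ?case using assms by (simp add: ren_binders step.step_outH inj_eq)
next
  case (step_inF h x P v)
  then show ?case using assms by (simp add: psubst_ren[symmetric] step.step_inF)
next
  case (step_repH a x b P \<mu> Q)
  then show ?case using assms by (simp add: ren_binders step.step_repH)
next
  case (step_nuH P \<mu> P' n)
  then show ?case using assms
    by (simp add: ren_binders step.step_nuH inj_image_mem_iff)
next
  case (step_nuF P \<mu> P' h)
  then show ?case using assms by (simp add: ren_binders step.step_nuF)
next
  case (step_commH1 P a v b P' Q Q')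
  then show ?case using assms by (auto simp: ren_binders intro: step.step_commH1)
next
  case (step_commH2 P a v b P' Q Q')
  then show ?case using assms by (auto simp: ren_binders intro: step.step_commH2)
next
  case (step_par1 P \<mu> P' Q)
  then show ?case using assms
    by (simp add: step.step_par1 image_Int[symmetric])
next
  case (step_par2 Q \<mu> Q' P)
  then show ?case using assms
    by (simp add: step.step_par2 image_Int[symmetric])
qed (auto intro: step.intros)

section \<open>Changing the bound name of a transition\<close>

primrec act_rebind :: "hname \<Rightarrow> 'v action \<Rightarrow> 'v action" where
  "act_rebind c Tau = Tau"
| "act_rebind c (AInH a v b) = AInH a v c"
| "act_rebind c (AOutH a v b) = AOutH a v c"
| "act_rebind c (AInF h v) = AInF h v"
| "act_rebind c (AOutF h v) = AOutF h v"
| "act_rebind c (ASucc w) = ASucc w"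

lemma act_names_rebind [simp]:
  "act_fhn (act_rebind c \<mu>) = act_fhn \<mu>"
  "act_ffn (act_rebind c \<mu>) = act_ffn \<mu>"
  by (cases \<mu>; simp)+

lemma set_act_bhn_rebind: "set (act_bhn (act_rebind c \<mu>)) \<subseteq> {c}"
  by (cases \<mu>) auto

lemma act_bhn_eq: "b \<in> set (act_bhn \<mu>) \<Longrightarrow> set (act_bhn \<mu>) = {b}"
  by (cases \<mu>) auto

text \<open>The derivation is kept and only the name chosen at the prefix is replaced. Each rule on
  the way forbids finitely many names (free names of an idle component, the name of a restriction),
  and \<open>A\<close> collects them.\<close>

lemma step_rebind_cofinite:
  "step I P \<mu> P' \<Longrightarrow> \<exists>A. finite A \<and> (\<forall>b c. b \<in> set (act_bhn \<mu>) \<longrightarrow> c \<notin> A \<longrightarrow>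
     step I P (act_rebind c \<mu>) (ren (transpose b c) P'))"
proof (induction rule: step.induct)
  case (step_inH b a x P v)
  have "step I (inH a x b P) (AInH a v c) (ren (transpose b c) (psubst x v P))"
    if "c \<notin> insert a (fhn P)" for c
    using step.step_inH[of c a I x "ren (transpose b c) P" v] that inH_alpha[of c P b]
    by (simp add: psubst_ren)
  then show ?case by (intro exI[of _ "insert a (fhn P)"]) auto
next
  case (step_outH b a e v P)
  have "step I (outH a e b P) (AOutH a v c) (ren (transpose b c) P)"
    if "c \<notin> insert a (fhn P)" for c
    using step.step_outH[of c a I e v "ren (transpose b c) P"] that step_outH outH_alpha[of c P b]
    by simp
  then show ?case by (intro exI[of _ "insert a (fhn P)"]) auto
next
  case (step_repH a x b P \<mu> Q)
  then obtain A where A: "finite A" "\<And>b' c. b' \<in> set (act_bhn \<mu>) \<Longrightarrow> c \<notin> A \<Longrightarrow>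
     step I (inH a x b P) (act_rebind c \<mu>) (ren (transpose b' c) Q)" by blast
  have "step I (repH a x b P) (act_rebind c \<mu>) (ren (transpose b' c) (Par Q (repH a x b P)))"
    if "b' \<in> set (act_bhn \<mu>)" "c \<notin> A \<union> fhn (repH a x b P)" for b' c
  proof -
    have "b' \<notin> fhn (repH a x b P)" using step_repH.hyps that(1)
      by (auto elim!: step_inHE)
    then have "ren (transpose b' c) (repH a x b P) = repH a x b P"
      using that by (intro ren_transpose_fresh) auto
    then show ?thesis using A(2)[OF that(1)] that by (auto intro: step.step_repH)
  qed
  with A(1) show ?case by (intro exI[of _ "A \<union> fhn (repH a x b P)"]) auto
next
  case (step_repF h x P \<mu> Q)
  then have "act_bhn \<mu> = []" by (auto elim: step_InFE)
  then show ?case by auto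
next
  case (step_nuH P \<mu> P' n)
  then obtain A where A: "finite A" "\<And>b c. b \<in> set (act_bhn \<mu>) \<Longrightarrow> c \<notin> A \<Longrightarrow>
     step I P (act_rebind c \<mu>) (ren (transpose b c) P')" by blast
  have "step I (nuH n P) (act_rebind c \<mu>) (ren (transpose b c) (nuH n P'))"
    if "b \<in> set (act_bhn \<mu>)" "c \<notin> insert n A" for b c
  proof -
    have "n \<noteq> b" "n \<noteq> c" using that step_nuH by auto
    then have "ren (transpose b c) (nuH n P') = nuH n (ren (transpose b c) P')"
      by (simp add: ren_binders)
    then show ?thesis using A(2)[OF that(1), of c] that step_nuH.hyps set_act_bhn_rebind[of c \<mu>]
      by (auto intro!: step.step_nuH)
  qed
  with A(1) show ?case by (intro exI[of _ "insert n A"]) auto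
next
  case (step_nuF P \<mu> P' h)
  then obtain A where "finite A" "\<And>b c. b \<in> set (act_bhn \<mu>) \<Longrightarrow> c \<notin> A \<Longrightarrow>
     step I P (act_rebind c \<mu>) (ren (transpose b c) P')" by blast
  with step_nuF.hyps show ?case
    by (intro exI[of _ A]) (auto simp: ren_binders intro: step.step_nuF)
next
  case (step_par1 P \<mu> P' Q)
  then obtain A where A: "finite A" "\<And>b c. b \<in> set (act_bhn \<mu>) \<Longrightarrow> c \<notin> A \<Longrightarrow>
     step I P (act_rebind c \<mu>) (ren (transpose b c) P')" by blast
  have "step I (Par P Q) (act_rebind c \<mu>) (ren (transpose b c) (Par P' Q))"
    if "b \<in> set (act_bhn \<mu>)" "c \<notin> A \<union> fhn Q" for b c
  proof -
    have "ren (transpose b c) Q = Q"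
      using that step_par1.hyps by (intro ren_transpose_fresh) auto
    then show ?thesis
      using A(2)[OF that(1), of c] that set_act_bhn_rebind[of c \<mu>]
      by (auto intro!: step.step_par1)
  qed
  with A(1) show ?case by (intro exI[of _ "A \<union> fhn Q"]) auto
next
  case (step_par2 Q \<mu> Q' P)
  then obtain A where A: "finite A" "\<And>b c. b \<in> set (act_bhn \<mu>) \<Longrightarrow> c \<notin> A \<Longrightarrow>
     step I Q (act_rebind c \<mu>) (ren (transpose b c) Q')" by blast
  have "step I (Par P Q) (act_rebind c \<mu>) (ren (transpose b c) (Par P Q'))"
    if "b \<in> set (act_bhn \<mu>)" "c \<notin> A \<union> fhn P" for b c
  proof -
    have "ren (transpose b c) P = P"
      using that step_par2.hyps by (intro ren_transpose_fresh) auto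
    then show ?thesis
      using A(2)[OF that(1), of c] that set_act_bhn_rebind[of c \<mu>]
      by (auto intro!: step.step_par2)
  qed
  with A(1) show ?case by (intro exI[of _ "A \<union> fhn P"]) auto
qed (simp; blast intro: step.intros)+

text \<open>A restriction inside \<open>P\<close> may use the name \<open>c\<close>. The bound name is therefore first changed to
  one avoiding all such names, and equivariance then exchanges it with \<open>c\<close>.\<close>

lemma step_rebind:
  assumes "step I P \<mu> P'" and "b \<in> set (act_bhn \<mu>)" and "c \<notin> fhn P"
  shows "step I P (act_rebind c \<mu>) (ren (transpose b c) P')"
proof (cases "b = c")
  case True
  then have "act_rebind c \<mu> = \<mu>" using assms(2) by (cases \<mu>) auto
  then show ?thesis using assms True by (simp add: ren_idem)
next
  case False
  from step_rebind_cofinite[OF assms(1)] obtain A where A: "finite A"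
    "\<And>d. d \<notin> A \<Longrightarrow> step I P (act_rebind d \<mu>) (ren (transpose b d) P')" using assms(2) by blast
  obtain d where d: "d \<notin> A \<union> fhn P \<union> fhn P' \<union> {b, c}"
    using ex_new_if_finite[of "A \<union> fhn P \<union> fhn P' \<union> {b, c}"] A(1) by auto
  have c: "c \<notin> fhn P'" "act_fhn \<mu> \<subseteq> fhn P"
    using step_fhn[OF assms(1)] assms(3) False act_bhn_eq[OF assms(2)] by auto
  have "act_ren (transpose d c) (act_rebind d \<mu>) = act_rebind c \<mu>"
    using c(2) assms(3) d by (cases \<mu>) (auto simp: transpose_def)
  moreover have "ren (transpose d c) P = P" using d assms(3) by (intro ren_transpose_fresh) auto
  moreover have "ren (transpose d c) (ren (transpose b d) P') = ren (transpose b c) P'"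
    unfolding ren_comp using c d by (intro ren_cong) (auto simp: transpose_def)
  ultimately show ?thesis
    using step_ren[OF _ A(2)[of d], of "transpose d c"] d by simp
qed

text \<open>The derivation may have opened the restriction with another name \<open>n\<close>.
  Neither \<open>n\<close> nor \<open>a\<close> occurs in the action, so swapping them changes only
  the process and restores the representative \<open>P\<close>.\<close>

lemma step_nuHE:
  assumes "step I (nuH a P) \<mu> Q" and "a \<notin> set (act_bhn \<mu>)"
  obtains P' where "step I P \<mu> P'" "Q = nuH a P'"
  using assms(1)
proof (cases rule: step.cases)
  case (step_nuH P0 P0' n)
  have eq: "closeH 0 a P = closeH 0 n P0" using step_nuH(1) by (simp add: binder_defs)
  have P: "P = ren (transpose n a) P0" "a \<notin> fhn P0 \<or> a = n" using closeH_eqD[OF eq] by auto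
  have "a \<notin> act_fhn \<mu>" using step_fhn[OF assms(1)] by auto
  then have "act_ren (transpose n a) \<mu> = \<mu>"
    using step_nuH assms(2) by (intro act_ren_idem) (auto simp: transpose_def)
  then have "step I P \<mu> (ren (transpose n a) P0')"
    using step_ren[OF _ step_nuH(3), of "transpose n a"] P by simp
  moreover have "a \<notin> fhn P0' \<or> a = n" using step_fhn[OF step_nuH(3)] P(2) assms(2) by auto
  then have "Q = nuH a (ren (transpose n a) P0')" using step_nuH(2) by (simp add: nuH_alpha)
  ultimately show ?thesis using that by blast
qed (simp_all add: binder_defs)

section \<open>Visibility functions\<close>

declare domIff [iff del]

lemma visI: "dom \<Gamma> = dom \<Gamma>' \<Longrightarrow> (\<And>p. vget \<Gamma> p = vget \<Gamma>' p) \<Longrightarrow> \<Gamma> = \<Gamma>'"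
proof (rule ext)
  fix p assume "dom \<Gamma> = dom \<Gamma>'" and *: "\<And>p. vget \<Gamma> p = vget \<Gamma>' p"
  then have "p \<in> dom \<Gamma> \<longleftrightarrow> p \<in> dom \<Gamma>'" by auto
  with *[of p] show "\<Gamma> p = \<Gamma>' p" by (auto simp: vget_def dom_def split: option.splits)
qed

lemma vget_upd [simp]: "vget (\<Gamma>(p \<mapsto> V)) q = (if q = p then V else vget \<Gamma> q)"
  by (simp add: vget_def)

lemma dom_verase [simp]: "dom (verase \<Gamma> p) = dom \<Gamma> - {p}"
  by (auto simp: verase_def dom_def)

lemma vget_verase [simp]: "vget (verase \<Gamma> p) q = (if q = p then {} else vget \<Gamma> q - {a. Nm a = p})"
  by (auto simp: verase_def vget_def split: option.splits)

lemma dom_vunion [simp]: "dom (vunion \<Gamma>\<^sub>1 \<Gamma>\<^sub>2) = dom \<Gamma>\<^sub>1 \<union> dom \<Gamma>\<^sub>2"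
  by (auto simp: vunion_def dom_def)

lemma vget_notin_dom: "p \<notin> dom \<Gamma> \<Longrightarrow> vget \<Gamma> p = {}"
  by (auto simp: vget_def dom_def)

lemma vget_vunion [simp]: "vget (vunion \<Gamma>\<^sub>1 \<Gamma>\<^sub>2) p = vget \<Gamma>\<^sub>1 p \<union> vget \<Gamma>\<^sub>2 p"
proof (cases "p \<in> dom \<Gamma>\<^sub>1 \<union> dom \<Gamma>\<^sub>2")
  case True
  then have "vunion \<Gamma>\<^sub>1 \<Gamma>\<^sub>2 p = Some (vget \<Gamma>\<^sub>1 p \<union> vget \<Gamma>\<^sub>2 p)" by (simp add: vunion_def)
  then show ?thesis by (subst vget_def) simp
next
  case False
  then show ?thesis by (simp add: vget_notin_dom)
qed

lemma vnames_iff: "a \<in> vnames \<Gamma> \<longleftrightarrow> Nm a \<in> dom \<Gamma> \<or> (\<exists>p. a \<in> vget \<Gamma> p)"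
  by (fastforce simp: vnames_def vget_def ran_def dom_def split: option.splits)

text \<open>Outside the domain \<open>vget\<close> is empty, so the quantifiers can range over all
  tokens.\<close>

lemma visibility_iff: "visibility \<Gamma> \<longleftrightarrow> finite (dom \<Gamma>) \<and> (\<forall>p. finite (vget \<Gamma> p)) \<and>
    (\<forall>p a. Nm a \<in> dom \<Gamma> \<longrightarrow> a \<in> vget \<Gamma> p \<longrightarrow> vget \<Gamma> (Nm a) \<subseteq> vget \<Gamma> p)"
proof -
  have "(\<forall>V\<in>ran \<Gamma>. finite V) \<longleftrightarrow> (\<forall>p. finite (vget \<Gamma> p))"
    by (auto simp: vget_def ran_def split: option.splits)
  moreover have "a \<in> vget \<Gamma> p \<Longrightarrow> p \<in> dom \<Gamma>" for a p by (auto simp: vget_def dom_def split: option.splits)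
  ultimately show ?thesis unfolding visibility_def by (metis (no_types, lifting))
qed

lemma finite_vnames:
  assumes "visibility \<Gamma>" shows "finite (vnames \<Gamma>)"
proof -
  have "{a. Nm a \<in> dom \<Gamma>} = Nm -` dom \<Gamma>" by auto
  then have "finite {a. Nm a \<in> dom \<Gamma>}"
    using assms by (auto simp: visibility_def intro: finite_vimageI inj_onI)
  moreover have "finite (ran \<Gamma>)" using assms by (auto simp: visibility_def intro: finite_ran)
  ultimately show ?thesis using assms by (auto simp: vnames_def visibility_def)
qed

text \<open>The visibility functions of a thread after it receives control through \<open>a\<close> together with the
  fresh name \<open>b\<close>, and after it gives control away and keeps \<open>b\<close> for the answer.\<close>

definition vis_in :: "vis \<Rightarrow> hname \<Rightarrow> hname \<Rightarrow> vis" where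
  "vis_in \<Gamma> a b = \<Gamma>(Cur \<mapsto> vget \<Gamma> (Nm a) \<union> {b})"

definition vis_out :: "vis \<Rightarrow> hname \<Rightarrow> vis" where
  "vis_out \<Gamma> b = (verase \<Gamma> Cur)(Nm b \<mapsto> vget \<Gamma> Cur \<union> {b})"

lemma dom_vis_in [simp]: "dom (vis_in \<Gamma> a b) = insert Cur (dom \<Gamma>)"
  by (auto simp: vis_in_def)

lemma vget_vis_in [simp]:
  "vget (vis_in \<Gamma> a b) p = (if p = Cur then vget \<Gamma> (Nm a) \<union> {b} else vget \<Gamma> p)"
  by (simp add: vis_in_def)

lemma dom_vis_out [simp]: "dom (vis_out \<Gamma> b) = insert (Nm b) (dom \<Gamma> - {Cur})"
  by (auto simp: vis_out_def)

lemma vget_vis_out [simp]: "vget (vis_out \<Gamma> b) p =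
    (if p = Nm b then vget \<Gamma> Cur \<union> {b} else if p = Cur then {} else vget \<Gamma> p)"
  by (auto simp: vis_out_def)

lemma vnames_vis_in: "vnames (vis_in \<Gamma> a b) \<subseteq> vnames \<Gamma> \<union> {b}"
  and vnames_vis_out: "vnames (vis_out \<Gamma> b) \<subseteq> vnames \<Gamma> \<union> {b}"
  by (auto simp: vnames_iff split: if_splits)

text \<open>A name of the domain that \<open>Cur\<close> sees is either seen by \<open>a\<close>,
  where transitivity of \<Gamma> applies, or it is \<open>b\<close>, which forces
  \<open>b = a\<close>. The alternative \<open>b = a\<close> is needed for the joint visibility
  function in \<open>wt_comm\<close>.\<close>

lemma visibility_vis_in:
  assumes "visibility \<Gamma>" "b \<notin> vnames \<Gamma> \<or> b = a"
  shows "visibility (vis_in \<Gamma> a b)"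
  unfolding visibility_iff
proof (intro conjI allI impI)
  fix p c assume *: "Nm c \<in> dom (vis_in \<Gamma> a b)" "c \<in> vget (vis_in \<Gamma> a b) p"
  show "vget (vis_in \<Gamma> a b) (Nm c) \<subseteq> vget (vis_in \<Gamma> a b) p"
  proof (cases "p = Cur")
    case True
    with * assms(2) have "c = a \<or> c \<in> vget \<Gamma> (Nm a)" by (auto simp: vnames_iff)
    then show ?thesis using True * assms(1) unfolding visibility_iff by auto
  next
    case False
    then show ?thesis using * assms(1) unfolding visibility_iff by auto
  qed
qed (use assms in \<open>auto simp: visibility_iff\<close>)

lemma visibility_vis_out:
  assumes "visibility \<Gamma>" "b \<notin> vnames \<Gamma>"
  shows "visibility (vis_out \<Gamma> b)"
  unfolding visibility_iff
proof (intro conjI allI impI)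
  fix p c assume *: "Nm c \<in> dom (vis_out \<Gamma> b)" "c \<in> vget (vis_out \<Gamma> b) p"
  show "vget (vis_out \<Gamma> b) (Nm c) \<subseteq> vget (vis_out \<Gamma> b) p"
  proof (cases "p = Nm b")
    case True
    then show ?thesis using * assms(1) unfolding visibility_iff by (cases "c = b") auto
  next
    case False
    then have "p \<noteq> Cur" "c \<in> vget \<Gamma> p" using * by (auto split: if_splits)
    moreover from this have "c \<noteq> b" using assms(2) by (auto simp: vnames_iff)
    ultimately show ?thesis using * False assms(1) unfolding visibility_iff by auto
  qed
qed (use assms in \<open>auto simp: visibility_iff\<close>)

section \<open>The weakening order and the exchange of names in visibility functions\<close>

definition vle :: "vis \<Rightarrow> vis \<Rightarrow> bool" where
  "vle \<Gamma> \<Gamma>' \<longleftrightarrow> dom \<Gamma> \<subseteq> dom \<Gamma>' \<and> (\<forall>p. vget \<Gamma> p \<subseteq> vget \<Gamma>' p)"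

primrec tok_ren :: "(hname \<Rightarrow> hname) \<Rightarrow> tok \<Rightarrow> tok" where
  "tok_ren f Cur = Cur"
| "tok_ren f (Nm a) = Nm (f a)"

text \<open>The argument should be renamed by the inverse; a transposition is its own
  inverse.\<close>

definition vis_swap :: "hname \<Rightarrow> hname \<Rightarrow> vis \<Rightarrow> vis" where
  "vis_swap a b \<Gamma> = (\<lambda>p. map_option ((`) (transpose a b)) (\<Gamma> (tok_ren (transpose a b) p)))"

lemma tok_ren_transpose [simp]: "tok_ren (transpose a b) (tok_ren (transpose a b) p) = p"
  by (cases p) auto

lemma in_dom_vis_swap [simp]: "p \<in> dom (vis_swap a b \<Gamma>) \<longleftrightarrow> tok_ren (transpose a b) p \<in> dom \<Gamma>"
  by (auto simp: vis_swap_def dom_def)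

lemma vget_vis_swap: "vget (vis_swap a b \<Gamma>) p = transpose a b ` vget \<Gamma> (tok_ren (transpose a b) p)"
  by (auto simp: vis_swap_def vget_def split: option.splits)

lemma in_vget_vis_swap [simp]: "c \<in> vget (vis_swap a b \<Gamma>) p \<longleftrightarrow>
    transpose a b c \<in> vget \<Gamma> (tok_ren (transpose a b) p)"
  by (simp add: vget_vis_swap in_transpose_image_iff)

lemma in_vnames_vis_swap [simp]: "c \<in> vnames (vis_swap a b \<Gamma>) \<longleftrightarrow> transpose a b c \<in> vnames \<Gamma>"
proof -
  have "(\<exists>p. transpose a b c \<in> vget \<Gamma> (tok_ren (transpose a b) p)) \<longleftrightarrow>
      (\<exists>p. transpose a b c \<in> vget \<Gamma> p)"
    by (rule iffI; erule exE) (blast, metis tok_ren_transpose)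
  then show ?thesis unfolding vnames_iff in_dom_vis_swap in_vget_vis_swap by simp
qed

lemma visibility_vis_swap:
  assumes "visibility \<Gamma>" shows "visibility (vis_swap a b \<Gamma>)"
proof -
  have "dom (vis_swap a b \<Gamma>) = tok_ren (transpose a b) ` dom \<Gamma>"
  proof (rule set_eqI)
    fix p
    show "p \<in> dom (vis_swap a b \<Gamma>) \<longleftrightarrow> p \<in> tok_ren (transpose a b) ` dom \<Gamma>"
      unfolding in_dom_vis_swap image_iff by (metis tok_ren_transpose)
  qed
  then have "finite (dom (vis_swap a b \<Gamma>))" using assms by (simp add: visibility_iff)
  moreover have "finite (vget (vis_swap a b \<Gamma>) p)" for p
    using assms by (simp add: vget_vis_swap visibility_iff)
  ultimately show ?thesis using assms unfolding visibility_iff subset_iff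
    in_dom_vis_swap in_vget_vis_swap tok_ren.simps by blast
qed

lemma transpose_eq_iff': "transpose a b c = d \<longleftrightarrow> c = transpose a b d"
  by (metis transpose_involutory)

lemma tok_ren_eq_iff:
  "tok_ren (transpose a b) p = Cur \<longleftrightarrow> p = Cur"
  "tok_ren (transpose a b) p = Nm c \<longleftrightarrow> p = Nm (transpose a b c)"
  by (cases p; simp add: transpose_eq_iff')+

lemma vis_swapI:
  assumes "\<And>p. p \<in> dom \<Gamma>' \<longleftrightarrow> tok_ren (transpose a b) p \<in> dom \<Gamma>"
    and "\<And>p c. c \<in> vget \<Gamma>' p \<longleftrightarrow> transpose a b c \<in> vget \<Gamma> (tok_ren (transpose a b) p)"
  shows "vis_swap a b \<Gamma> = \<Gamma>'"
  by (rule visI; rule set_eqI) (simp_all only: assms in_dom_vis_swap in_vget_vis_swap)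

lemma vis_swap_vis_in: "vis_swap a b (vis_in \<Gamma> c d) =
    vis_in (vis_swap a b \<Gamma>) (transpose a b c) (transpose a b d)"
proof (rule vis_swapI)
  fix p
  show "p \<in> dom (vis_in (vis_swap a b \<Gamma>) (transpose a b c) (transpose a b d)) \<longleftrightarrow>
      tok_ren (transpose a b) p \<in> dom (vis_in \<Gamma> c d)"
    by (simp add: tok_ren_eq_iff transpose_eq_iff')
  fix n
  show "n \<in> vget (vis_in (vis_swap a b \<Gamma>) (transpose a b c) (transpose a b d)) p \<longleftrightarrow>
      transpose a b n \<in> vget (vis_in \<Gamma> c d) (tok_ren (transpose a b) p)"
    by (simp add: tok_ren_eq_iff transpose_eq_iff')
qed

lemma vis_swap_vis_out: "vis_swap a b (vis_out \<Gamma> d) = vis_out (vis_swap a b \<Gamma>) (transpose a b d)"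
proof (rule vis_swapI)
  fix p
  show "p \<in> dom (vis_out (vis_swap a b \<Gamma>) (transpose a b d)) \<longleftrightarrow>
      tok_ren (transpose a b) p \<in> dom (vis_out \<Gamma> d)"
    by (simp add: tok_ren_eq_iff transpose_eq_iff')
  fix n
  show "n \<in> vget (vis_out (vis_swap a b \<Gamma>) (transpose a b d)) p \<longleftrightarrow>
      transpose a b n \<in> vget (vis_out \<Gamma> d) (tok_ren (transpose a b) p)"
    by (simp add: tok_ren_eq_iff transpose_eq_iff')
qed

lemma vis_swap_verase:
  "vis_swap a b (verase \<Gamma> (Nm c)) = verase (vis_swap a b \<Gamma>) (Nm (transpose a b c))"
proof (rule vis_swapI)
  fix p
  show "p \<in> dom (verase (vis_swap a b \<Gamma>) (Nm (transpose a b c))) \<longleftrightarrow>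
      tok_ren (transpose a b) p \<in> dom (verase \<Gamma> (Nm c))"
    by (simp add: tok_ren_eq_iff transpose_eq_iff')
  fix n
  show "n \<in> vget (verase (vis_swap a b \<Gamma>) (Nm (transpose a b c))) p \<longleftrightarrow>
      transpose a b n \<in> vget (verase \<Gamma> (Nm c)) (tok_ren (transpose a b) p)"
    by (simp add: tok_ren_eq_iff transpose_eq_iff')
qed

lemma vle_vis_swap: "vle \<Gamma> \<Gamma>' \<Longrightarrow> vle (vis_swap a b \<Gamma>) (vis_swap a b \<Gamma>')"
  unfolding vle_def subset_iff in_dom_vis_swap in_vget_vis_swap by blast

lemma vis_swap_fresh:
  assumes "a \<notin> vnames \<Gamma>" "b \<notin> vnames \<Gamma>" shows "vis_swap a b \<Gamma> = \<Gamma>"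
proof -
  have "p \<in> dom (vis_swap a b \<Gamma>) \<longleftrightarrow> p \<in> dom \<Gamma>" for p
    using assms by (cases p) (auto simp: vnames_iff transpose_def)
  moreover have "c \<in> vget (vis_swap a b \<Gamma>) p \<longleftrightarrow> c \<in> vget \<Gamma> p" for c p
  proof -
    have "tok_ren (transpose a b) p = p \<or> p \<notin> dom \<Gamma> \<and> tok_ren (transpose a b) p \<notin> dom \<Gamma>"
      using assms by (cases p) (auto simp: vnames_iff transpose_def)
    moreover have "transpose a b c = c \<or> c \<notin> vget \<Gamma> p \<and> transpose a b c \<notin> vget \<Gamma> p"
      using assms by (auto simp: vnames_iff transpose_def)
    ultimately show ?thesis unfolding in_vget_vis_swap by (metis vget_notin_dom)
  qed
  ultimately show ?thesis by (intro visI set_eqI) auto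
qed

section \<open>The control token\<close>

text \<open>\<open>cur_typed P c\<close> is what remains of a typing of \<open>P\<close> when only the presence \<open>c\<close> of \<open>Cur\<close> in the
  domain of the visibility function is recorded. Typed replicated inputs on first-order names do not
  exist, as their two requirements on \<open>Cur\<close> contradict each other.\<close>

primrec cur_typed :: "('f, 'v) proc \<Rightarrow> bool \<Rightarrow> bool" where
  "cur_typed (InH u x P) c \<longleftrightarrow> \<not> c \<and> cur_typed P True"
| "cur_typed (InF u x P) c \<longleftrightarrow> c \<and> cur_typed P True"
| "cur_typed (OutH u e P) c \<longleftrightarrow> c \<and> cur_typed P False"
| "cur_typed (OutF u e P) c \<longleftrightarrow> \<not> c \<and> cur_typed P False"
| "cur_typed (Succ w P) c \<longleftrightarrow> True"
| "cur_typed (RepH u x P) c \<longleftrightarrow> \<not> c \<and> cur_typed P True"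
| "cur_typed (RepF u x P) c \<longleftrightarrow> False"
| "cur_typed (Par P Q) c \<longleftrightarrow>
     (\<exists>c1 c2. c = (c1 \<or> c2) \<and> \<not> (c1 \<and> c2) \<and> cur_typed P c1 \<and> cur_typed Q c2)"
| "cur_typed (ResH P) c \<longleftrightarrow> cur_typed P c"
| "cur_typed (ResF P) c \<longleftrightarrow> cur_typed P c"
| "cur_typed Null c \<longleftrightarrow> \<not> c"
| "cur_typed (Sum P Q) c \<longleftrightarrow> cur_typed P c \<and> cur_typed Q c"
| "cur_typed (IfEq e f P Q) c \<longleftrightarrow> cur_typed P c \<and> cur_typed Q c"

lemma cur_typed_closeH [simp]: "cur_typed (closeH k b P) = cur_typed P"
  by (induction P arbitrary: k) (auto simp: fun_eq_iff)

lemma cur_typed_closeF [simp]: "cur_typed (closeF k h P) = cur_typed P"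
  by (induction P arbitrary: k) (auto simp: fun_eq_iff)

lemma cur_typed_psubst [simp]: "cur_typed (psubst x v P) = cur_typed P"
  by (induction P) (auto simp: fun_eq_iff)

lemma Cur_in_dom_if_vget: "a \<in> vget \<Delta> Cur \<Longrightarrow> Cur \<in> dom \<Delta>"
  by (auto simp: vget_def dom_def split: option.splits)

lemma typed_cur_typed: "\<Delta> \<turnstile> P \<Longrightarrow> cur_typed P (Cur \<in> dom \<Delta>)"
proof (induction rule: typed.induct)
  case (typed_outH \<Delta> a b P e)
  have "Cur \<notin> dom ((verase \<Delta> Cur)(Nm b \<mapsto> vget \<Delta> Cur \<union> {b}))" by simp
  with typed_outH.IH have "cur_typed P False" by (simp only:)
  then show ?case using Cur_in_dom_if_vget[OF typed_outH.hyps(2)] by (simp add: binder_defs)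
next
  case (typed_inH \<Delta> a b P x)
  have "Cur \<in> dom (\<Delta>(Cur \<mapsto> vget \<Delta> (Nm a) \<union> {b}))" by simp
  with typed_inH.IH have "cur_typed P True" by (simp only:)
  then show ?case using typed_inH.hyps by (simp add: binder_defs)
next
  case (typed_nuH \<Delta> P a)
  then show ?case by (simp add: binder_defs)
next
  case (typed_par \<Delta> \<Delta>\<^sub>1 \<Delta>\<^sub>2 P\<^sub>1 P\<^sub>2)
  then have "Cur \<in> dom \<Delta> \<longleftrightarrow> Cur \<in> dom \<Delta>\<^sub>1 \<or> Cur \<in> dom \<Delta>\<^sub>2" "\<not> (Cur \<in> dom \<Delta>\<^sub>1 \<and> Cur \<in> dom \<Delta>\<^sub>2)"
    by (auto simp: vsplit_def)
  with typed_par show ?case by auto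
qed (auto simp: binder_defs)

text \<open>Internal steps, higher-order outputs and first-order inputs need the token; this is what
  makes the internal steps of a tested process type-allowed. A passive component beside an active
  one may still offer a higher-order input, which would create a second token, so nothing is claimed
  for that input when \<open>c\<close> holds. First-order outputs come from passive components and
  leave the token where it is.\<close>

primrec cur_after :: "bool \<Rightarrow> 'v action \<Rightarrow> ('f, 'v) proc \<Rightarrow> bool" where
  "cur_after c Tau P \<longleftrightarrow> c \<and> cur_typed P True"
| "cur_after c (AInH a v b) P \<longleftrightarrow> \<not> c \<longrightarrow> cur_typed P True"
| "cur_after c (AOutH a v b) P \<longleftrightarrow> c \<and> cur_typed P False"
| "cur_after c (AInF h v) P \<longleftrightarrow> c \<and> cur_typed P True"
| "cur_after c (AOutF h v) P \<longleftrightarrow> cur_typed P c"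
| "cur_after c (ASucc w) P \<longleftrightarrow> True"

lemma step_cur_typed: "step I P \<mu> P' \<Longrightarrow> cur_typed P c \<Longrightarrow> cur_after c \<mu> P'"
proof (induction arbitrary: c rule: step.induct)
  case (step_repH a x b P \<mu> Q)
  then have "cur_after c \<mu> Q" "\<not> c" "cur_typed (repH a x b P) False" by (auto simp: binder_defs)
  with step_repH.hyps show ?case by (auto simp: ex_bool_eq elim!: step_inHE)
next
  case (step_nuH P \<mu> P' n)
  then have "cur_after c \<mu> P'" by (simp add: binder_defs)
  then show ?case by (cases \<mu>) (auto simp: binder_defs)
next
  case (step_nuF P \<mu> P' n)
  then have "cur_after c \<mu> P'" by (simp add: binder_defs)
  then show ?case by (cases \<mu>) (auto simp: binder_defs)
next
  case (step_commH1 P a v b P' Q Q')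
  then obtain c1 c2 where "c = (c1 \<or> c2)" "\<not> (c1 \<and> c2)" "cur_typed P c1" "cur_typed Q c2" by auto
  with step_commH1.IH(1)[of c1] step_commH1.IH(2)[of c2] show ?case by (auto simp: binder_defs ex_bool_eq)
next
  case (step_commH2 P a v b P' Q Q')
  then obtain c1 c2 where "c = (c1 \<or> c2)" "\<not> (c1 \<and> c2)" "cur_typed P c1" "cur_typed Q c2" by auto
  with step_commH2.IH(1)[of c1] step_commH2.IH(2)[of c2] show ?case by (auto simp: binder_defs ex_bool_eq)
next
  case (step_commF1 P h v P' Q Q')
  then obtain c1 c2 where "c = (c1 \<or> c2)" "\<not> (c1 \<and> c2)" "cur_typed P c1" "cur_typed Q c2" by auto
  with step_commF1.IH(1)[of c1] step_commF1.IH(2)[of c2] show ?case by (auto simp: ex_bool_eq)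
next
  case (step_commF2 P h v P' Q Q')
  then obtain c1 c2 where "c = (c1 \<or> c2)" "\<not> (c1 \<and> c2)" "cur_typed P c1" "cur_typed Q c2" by auto
  with step_commF2.IH(1)[of c1] step_commF2.IH(2)[of c2] show ?case by (auto simp: ex_bool_eq)
next
  case (step_par1 P \<mu> P' Q)
  then obtain c1 c2 where "c = (c1 \<or> c2)" "\<not> (c1 \<and> c2)" "cur_typed P c1" "cur_typed Q c2" by auto
  with step_par1.IH[of c1] show ?case by (cases \<mu>) (auto simp: ex_bool_eq)
next
  case (step_par2 Q \<mu> Q' P)
  then obtain c1 c2 where "c = (c1 \<or> c2)" "\<not> (c1 \<and> c2)" "cur_typed P c1" "cur_typed Q c2" by auto
  with step_par2.IH[of c2] show ?case by (cases \<mu>) (auto simp: ex_bool_eq)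
qed (auto simp: binder_defs)

section \<open>A relaxed typing of testers\<close>

text \<open>Compared with \<open>typed\<close>, components and bodies of restrictions may be typed with less than
  what is available. This builds weakening into the rules that need it for subject reduction. The
  rules ignore first-order names and those requirements on \<open>Cur\<close> that also follow from
  \<open>cur_typed\<close> of the tested process.\<close>

inductive wt :: "vis \<Rightarrow> ('f, 'v) proc \<Rightarrow> bool" where
  wt_outH: "visibility \<Gamma> \<Longrightarrow> a \<in> vget \<Gamma> Cur \<Longrightarrow> b \<notin> vnames \<Gamma> \<Longrightarrow> wt (vis_out \<Gamma> b) P \<Longrightarrow>
    wt \<Gamma> (outH a e b P)"
| wt_inH: "visibility \<Gamma> \<Longrightarrow> Nm a \<in> dom \<Gamma> \<Longrightarrow> b \<notin> vnames \<Gamma> \<Longrightarrow> wt (vis_in \<Gamma> a b) P \<Longrightarrow>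
    wt \<Gamma> (inH a x b P)"
| wt_repH: "visibility \<Gamma> \<Longrightarrow> Nm a \<in> dom \<Gamma> \<Longrightarrow> b \<notin> vnames \<Gamma> \<Longrightarrow> wt (vis_in \<Gamma> a b) P \<Longrightarrow>
    wt \<Gamma> (repH a x b P)"
| wt_outF: "wt \<Gamma> P \<Longrightarrow> wt \<Gamma> (OutF u e P)"
| wt_inF: "wt \<Gamma> P \<Longrightarrow> Cur \<in> dom \<Gamma> \<Longrightarrow> wt \<Gamma> (InF u x P)"
| wt_succ: "wt \<Gamma> (Succ w P)"
| wt_nuH: "wt \<Gamma>\<^sub>0 P \<Longrightarrow> a \<notin> vnames \<Gamma> \<Longrightarrow> vle (verase \<Gamma>\<^sub>0 (Nm a)) \<Gamma> \<Longrightarrow> wt \<Gamma> (nuH a P)"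
| wt_ResF: "wt \<Gamma> P \<Longrightarrow> wt \<Gamma> (ResF P)"
| wt_null: "wt \<Gamma> Null"
| wt_sum: "wt \<Gamma> P\<^sub>1 \<Longrightarrow> wt \<Gamma> P\<^sub>2 \<Longrightarrow> wt \<Gamma> (Sum P\<^sub>1 P\<^sub>2)"
| wt_if: "wt \<Gamma> P\<^sub>1 \<Longrightarrow> wt \<Gamma> P\<^sub>2 \<Longrightarrow> wt \<Gamma> (IfEq e f P\<^sub>1 P\<^sub>2)"
| wt_par: "visibility \<Gamma> \<Longrightarrow> vle \<Gamma>\<^sub>1 \<Gamma> \<Longrightarrow> vle \<Gamma>\<^sub>2 \<Gamma> \<Longrightarrow> Cur \<notin> dom \<Gamma>\<^sub>1 \<inter> dom \<Gamma>\<^sub>2 \<Longrightarrow>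
    wt \<Gamma>\<^sub>1 P\<^sub>1 \<Longrightarrow> wt \<Gamma>\<^sub>2 P\<^sub>2 \<Longrightarrow> wt \<Gamma> (Par P\<^sub>1 P\<^sub>2)"

text \<open>A common generalisation of \<open>closeF\<close> and its inverse.\<close>

primrec map_focc :: "(nat \<Rightarrow> occ \<Rightarrow> occ) \<Rightarrow> nat \<Rightarrow> ('f, 'v) proc \<Rightarrow> ('f, 'v) proc" where
  "map_focc f k (InH u x P) = InH u x (map_focc f k P)"
| "map_focc f k (InF u x P) = InF (f k u) x (map_focc f k P)"
| "map_focc f k (OutH u e P) = OutH u e (map_focc f k P)"
| "map_focc f k (OutF u e P) = OutF (f k u) e (map_focc f k P)"
| "map_focc f k (Succ w P) = Succ w (map_focc f k P)"
| "map_focc f k (RepH u x P) = RepH u x (map_focc f k P)"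
| "map_focc f k (RepF u x P) = RepF (f k u) x (map_focc f k P)"
| "map_focc f k (Par P Q) = Par (map_focc f k P) (map_focc f k Q)"
| "map_focc f k (ResH P) = ResH (map_focc f k P)"
| "map_focc f k (ResF P) = ResF (map_focc f (Suc k) P)"
| "map_focc f k Null = Null"
| "map_focc f k (Sum P Q) = Sum (map_focc f k P) (map_focc f k Q)"
| "map_focc f k (IfEq e g P Q) = IfEq e g (map_focc f k P) (map_focc f k Q)"

definition open_occ :: "nat \<Rightarrow> nat \<Rightarrow> occ \<Rightarrow> occ" where
  "open_occ k b u = (case u of
      Free a \<Rightarrow> Free a
    | Bound i \<Rightarrow> (if i < k then Bound i else if i = k then Free b else Bound (i - 1)))"

lemma closeF_eq_map_focc: "closeF k h P = map_focc (\<lambda>k. close_occ k h) k P"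
  by (induction P arbitrary: k) auto

lemma open_occ_closeF: "map_focc (\<lambda>k. open_occ k h) k (closeF k h P) = P"
proof -
  have "open_occ k h (close_occ k h u) = u" for k u
    by (cases u) (auto simp: open_occ_def close_occ_def)
  then show ?thesis by (induction P arbitrary: k) auto
qed

lemma map_focc_closeH: "map_focc f k (closeH i b P) = closeH i b (map_focc f k P)"
  by (induction P arbitrary: i k) auto

lemma fhn_map_focc [simp]: "fhn (map_focc f k P) = fhn P"
  by (induction P arbitrary: k) auto

lemma map_focc_binders:
  "map_focc f k (inH a x b P) = inH a x b (map_focc f k P)"
  "map_focc f k (repH a x b P) = repH a x b (map_focc f k P)"
  "map_focc f k (outH a e b P) = outH a e b (map_focc f k P)"
  "map_focc f k (nuH b P) = nuH b (map_focc f k P)"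
  by (simp_all add: binder_defs map_focc_closeH)

text \<open>The offset \<open>m\<close> counts the binders that only the inner map has entered; it
  is 1 when the body of a restriction is opened.\<close>

lemma map_focc_comp:
  "map_focc f k (map_focc g (k + m) P) = map_focc (\<lambda>i. f i \<circ> g (i + m)) k P"
proof (induction P arbitrary: k)
  case (ResF P)
  show ?case using ResF[of "Suc k"] by simp
qed simp_all

lemma wt_map_focc: "wt \<Gamma> P \<Longrightarrow> wt \<Gamma> (map_focc f k P)"
proof (induction arbitrary: k rule: wt.induct)
  case (wt_outH \<Gamma> a b P e)
  then show ?case using wt.wt_outH[of \<Gamma> a b "map_focc f k P" e] by (simp add: binder_defs map_focc_closeH)
next
  case (wt_inH \<Gamma> a b P x)
  then show ?case using wt.wt_inH[of \<Gamma> a b "map_focc f k P" x] by (simp add: binder_defs map_focc_closeH)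
next
  case (wt_repH \<Gamma> a b P x)
  then show ?case using wt.wt_repH[of \<Gamma> a b "map_focc f k P" x] by (simp add: binder_defs map_focc_closeH)
next
  case (wt_nuH \<Gamma>\<^sub>0 P a \<Gamma>)
  then show ?case using wt.wt_nuH[of \<Gamma>\<^sub>0 "map_focc f k P" a \<Gamma>] by (simp add: binder_defs map_focc_closeH)
next
  case (wt_par \<Gamma> \<Gamma>\<^sub>1 \<Gamma>\<^sub>2 P\<^sub>1 P\<^sub>2)
  then show ?case using wt.wt_par[of \<Gamma> \<Gamma>\<^sub>1 \<Gamma>\<^sub>2 "map_focc f k P\<^sub>1" "map_focc f k P\<^sub>2"] by simp
qed (simp_all add: wt.intros)

lemma wt_psubst: "wt \<Gamma> P \<Longrightarrow> wt \<Gamma> (psubst x v P)"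
proof (induction rule: wt.induct)
  case (wt_outH \<Gamma> a b P e)
  then show ?case using wt.wt_outH[of \<Gamma> a b "psubst x v P" "esubst x v e"]
    by (simp add: binder_defs psubst_closeH)
next
  case (wt_inH \<Gamma> a b P y)
  then show ?case using wt.wt_inH[of \<Gamma> a b P y] wt.wt_inH[of \<Gamma> a b "psubst x v P" y]
    by (auto simp: binder_defs psubst_closeH)
next
  case (wt_repH \<Gamma> a b P y)
  then show ?case using wt.wt_repH[of \<Gamma> a b P y] wt.wt_repH[of \<Gamma> a b "psubst x v P" y]
    by (auto simp: binder_defs psubst_closeH)
next
  case (wt_nuH \<Gamma>\<^sub>0 P a \<Gamma>)
  then show ?case using wt.wt_nuH[of \<Gamma>\<^sub>0 "psubst x v P" a \<Gamma>] by (simp add: binder_defs psubst_closeH)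
next
  case (wt_par \<Gamma> \<Gamma>\<^sub>1 \<Gamma>\<^sub>2 P\<^sub>1 P\<^sub>2)
  then show ?case using wt.wt_par[of \<Gamma> \<Gamma>\<^sub>1 \<Gamma>\<^sub>2 "psubst x v P\<^sub>1" "psubst x v P\<^sub>2"] by simp
qed (simp_all add: wt.intros)

lemma wt_swap: "wt \<Gamma> P \<Longrightarrow> wt (vis_swap c d \<Gamma>) (ren (transpose c d) P)"
proof (induction rule: wt.induct)
  case (wt_outH \<Gamma> a b P e)
  then show ?case
    by (simp add: ren_binders vis_swap_vis_out wt.wt_outH visibility_vis_swap)
next
  case (wt_inH \<Gamma> a b P x)
  then show ?case
    by (simp add: ren_binders vis_swap_vis_in wt.wt_inH visibility_vis_swap)
next
  case (wt_repH \<Gamma> a b P x)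
  then show ?case
    by (simp add: ren_binders vis_swap_vis_in wt.wt_repH visibility_vis_swap)
next
  case (wt_nuH \<Gamma>\<^sub>0 P a \<Gamma>)
  then have "vle (verase (vis_swap c d \<Gamma>\<^sub>0) (Nm (transpose c d a))) (vis_swap c d \<Gamma>)"
    using vle_vis_swap[OF wt_nuH.hyps(3)] by (simp add: vis_swap_verase)
  with wt_nuH show ?case
    by (auto simp: ren_binders intro!: wt.wt_nuH)
next
  case (wt_inF \<Gamma> P u x)
  then show ?case by (auto intro!: wt.wt_inF)
next
  case (wt_par \<Gamma> \<Gamma>\<^sub>1 \<Gamma>\<^sub>2 P\<^sub>1 P\<^sub>2)
  then show ?case
    by (auto intro!: wt.wt_par[of _ "vis_swap c d \<Gamma>\<^sub>1" "vis_swap c d \<Gamma>\<^sub>2"]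
        visibility_vis_swap vle_vis_swap)
qed (simp_all add: wt.intros)

lemma typed_wt: "\<Gamma> \<turnstile> P \<Longrightarrow> wt \<Gamma> P"
proof (induction rule: typed.induct)
  case (typed_outH \<Delta> a b P e)
  then have "wt (vis_out \<Delta> b) P" by (simp only: vis_out_def)
  with typed_outH show ?case by (auto intro: wt.wt_outH)
next
  case (typed_inH \<Delta> a b P x)
  then have "wt (vis_in \<Delta> a b) P" by (simp only: vis_in_def)
  with typed_inH show ?case by (auto intro: wt.wt_inH)
next
  case (typed_repH \<Delta> a x b P)
  from typed_repH.IH show ?case
  proof (cases rule: wt.cases)
    case (wt_inH a' b' P' x')
    then have "repH a x b P = repH a' x' b' P'" by (simp add: binder_defs)
    with wt_inH show ?thesis by (simp add: wt.wt_repH)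
  qed (simp_all add: binder_defs)
next
  case (typed_repF \<Delta> h x P)
  \<comment> \<open>Vacuous: \<open>wt_inF\<close> puts \<open>Cur\<close> into the domain,
    replication excludes it.\<close>
  from typed_repF.IH typed_repF.hyps(2) show ?case
    by (cases rule: wt.cases) (simp_all add: binder_defs)
next
  case (typed_nuH \<Delta> P a)
  then show ?case by (intro wt.wt_nuH[of \<Delta>]) (auto simp: vle_def vnames_iff split: if_splits)
next
  case (typed_nuF \<Delta> P h)
  then show ?case by (simp add: nuF_def wt_ResF closeF_eq_map_focc wt_map_focc)
next
  case (typed_par \<Delta> \<Delta>\<^sub>1 \<Delta>\<^sub>2 P\<^sub>1 P\<^sub>2)
  then show ?case by (intro wt.wt_par[of _ \<Delta>\<^sub>1 \<Delta>\<^sub>2]) (auto simp: vsplit_def vle_def)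
qed (auto intro: wt.intros)

text \<open>The residual of the tester is typed by exactly the update that \<open>tstep\<close>
  makes for the complementary action of the tested process. The premise on \<open>Cur\<close> for
  higher-order inputs has the same reason as in \<open>cur_after\<close>.\<close>

primrec wt_after :: "vis \<Rightarrow> 'v action \<Rightarrow> ('f, 'v) proc \<Rightarrow> bool" where
  "wt_after \<Gamma> Tau P \<longleftrightarrow> wt \<Gamma> P"
| "wt_after \<Gamma> (AInH a v b) P \<longleftrightarrow> Cur \<notin> dom \<Gamma> \<longrightarrow> Nm a \<in> dom \<Gamma> \<and> wt (vis_in \<Gamma> a b) P"
| "wt_after \<Gamma> (AOutH a v b) P \<longleftrightarrow> a \<in> vget \<Gamma> Cur \<and> wt (vis_out \<Gamma> b) P"
| "wt_after \<Gamma> (AInF h v) P \<longleftrightarrow> Cur \<in> dom \<Gamma> \<and> wt \<Gamma> P"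
| "wt_after \<Gamma> (AOutF h v) P \<longleftrightarrow> wt \<Gamma> P"
| "wt_after \<Gamma> (ASucc w) P \<longleftrightarrow> True"

lemma wt_vis_in_rename:
  assumes "wt (vis_in \<Gamma> a b) P" "b \<notin> vnames \<Gamma>" "b' \<notin> vnames \<Gamma>" "Nm a \<in> dom \<Gamma>"
  shows "wt (vis_in \<Gamma> a b') (ren (transpose b b') P)"
proof -
  have "transpose b b' a = a" using assms(2-4) by (auto simp: transpose_def vnames_iff)
  then show ?thesis
    using wt_swap[OF assms(1), of b b'] assms(2,3) by (simp add: vis_swap_vis_in vis_swap_fresh)
qed

lemma wt_vis_out_rename:
  assumes "wt (vis_out \<Gamma> b) P" "b \<notin> vnames \<Gamma>" "b' \<notin> vnames \<Gamma>"
  shows "wt (vis_out \<Gamma> b') (ren (transpose b b') P)"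
  using wt_swap[OF assms(1), of b b'] assms(2,3) by (simp add: vis_swap_vis_out vis_swap_fresh)

lemma vle_vis_in: "vle \<Gamma> \<Gamma>' \<Longrightarrow> vle (vis_in \<Gamma> a b) (vis_in \<Gamma>' a b)"
  by (auto simp: vle_def)

lemma vle_vis_out: "vle \<Gamma> \<Gamma>' \<Longrightarrow> vle (vis_out \<Gamma> b) (vis_out \<Gamma>' b)"
  by (auto simp: vle_def)

lemma vle_vis_in_passive: "vle \<Gamma> \<Gamma>' \<Longrightarrow> Cur \<notin> dom \<Gamma> \<Longrightarrow> vle \<Gamma> (vis_in \<Gamma>' a b)"
  by (auto simp: vle_def vget_notin_dom)

lemma vle_vis_out_passive:
  "vle \<Gamma> \<Gamma>' \<Longrightarrow> Cur \<notin> dom \<Gamma> \<Longrightarrow> b \<notin> vnames \<Gamma>' \<Longrightarrow> vle \<Gamma> (vis_out \<Gamma>' b)"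
  unfolding vle_def vnames_iff by (auto simp: vget_notin_dom) (metis subsetD vget_notin_dom empty_iff)

lemma vle_in_dom: "vle \<Gamma> \<Gamma>' \<Longrightarrow> p \<in> dom \<Gamma> \<Longrightarrow> p \<in> dom \<Gamma>'"
  and vle_in_vget: "vle \<Gamma> \<Gamma>' \<Longrightarrow> a \<in> vget \<Gamma> p \<Longrightarrow> a \<in> vget \<Gamma>' p"
  by (auto simp: vle_def)

lemma wt_ParE:
  assumes "wt \<Gamma> (Par P Q)"
  obtains \<Gamma>\<^sub>1 \<Gamma>\<^sub>2 where "visibility \<Gamma>" "vle \<Gamma>\<^sub>1 \<Gamma>" "vle \<Gamma>\<^sub>2 \<Gamma>" "Cur \<notin> dom \<Gamma>\<^sub>1 \<inter> dom \<Gamma>\<^sub>2" "wt \<Gamma>\<^sub>1 P" "wt \<Gamma>\<^sub>2 Q"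
  using assms by (cases rule: wt.cases) (auto simp: binder_defs)

lemma wt_par_sym: "wt \<Gamma> (Par P Q) \<Longrightarrow> wt \<Gamma> (Par Q P)"
  by (erule wt_ParE) (rule wt_par, auto)

text \<open>Whenever a higher-order action has to be accounted for, the idle component does not hold
  \<open>Cur\<close>. The update affects only \<open>Cur\<close> and the fresh name, so the
  visibility function of this component stays below the new total.\<close>

lemma wt_after_par1:
  assumes "wt_after \<Gamma>\<^sub>1 \<mu> P'" "set (act_bhn \<mu>) \<inter> vnames \<Gamma> = {}"
    "visibility \<Gamma>" "vle \<Gamma>\<^sub>1 \<Gamma>" "vle \<Gamma>\<^sub>2 \<Gamma>" "Cur \<notin> dom \<Gamma>\<^sub>1 \<inter> dom \<Gamma>\<^sub>2" "wt \<Gamma>\<^sub>2 Q"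
  shows "wt_after \<Gamma> \<mu> (Par P' Q)"
proof (cases \<mu>)
  case (AInH a v b)
  have "Nm a \<in> dom \<Gamma> \<and> wt (vis_in \<Gamma> a b) (Par P' Q)" if "Cur \<notin> dom \<Gamma>"
  proof -
    have "Cur \<notin> dom \<Gamma>\<^sub>1" "Cur \<notin> dom \<Gamma>\<^sub>2" using that assms(4,5) by (auto dest: vle_in_dom)
    then show ?thesis using assms AInH
      by (auto intro!: wt_par[of _ "vis_in \<Gamma>\<^sub>1 a b" \<Gamma>\<^sub>2] visibility_vis_in vle_vis_in
          vle_vis_in_passive dest: vle_in_dom)
  qed
  then show ?thesis using AInH by simp
next
  case (AOutH a v b)
  then have "a \<in> vget \<Gamma>\<^sub>1 Cur" using assms by simp
  then have "Cur \<notin> dom \<Gamma>\<^sub>2" using assms(6) by (auto dest: Cur_in_dom_if_vget)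
  then show ?thesis using assms AOutH
    by (auto intro!: wt_par[of _ "vis_out \<Gamma>\<^sub>1 b" \<Gamma>\<^sub>2] visibility_vis_out vle_vis_out
        vle_vis_out_passive dest: vle_in_vget)
qed (use assms in \<open>auto intro: wt_par dest: vle_in_dom\<close>)

text \<open>The thread that receives control through \<open>a\<close> sees no more than the sender, which sees \<open>a\<close>: this
  is where transitivity is used.\<close>

lemma wt_comm:
  assumes "visibility \<Gamma>" "vle \<Gamma>\<^sub>1 \<Gamma>" "vle \<Gamma>\<^sub>2 \<Gamma>" "Cur \<notin> dom \<Gamma>\<^sub>1 \<inter> dom \<Gamma>\<^sub>2" "b \<notin> vnames \<Gamma>"
    "wt_after \<Gamma>\<^sub>1 (AInH a v b) P'" "wt_after \<Gamma>\<^sub>2 (AOutH a v b) Q'"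
  shows "wt \<Gamma> (nuH b (Par P' Q'))" "wt \<Gamma> (nuH b (Par Q' P'))"
proof -
  have Q: "a \<in> vget \<Gamma>\<^sub>2 Cur" "wt (vis_out \<Gamma>\<^sub>2 b) Q'" using assms(7) by auto
  then have P: "Cur \<notin> dom \<Gamma>\<^sub>1" "Nm a \<in> dom \<Gamma>\<^sub>1" "wt (vis_in \<Gamma>\<^sub>1 a b) P'"
    using assms(4,6) by (auto dest: Cur_in_dom_if_vget)
  have a: "a \<in> vget \<Gamma> Cur" "Nm a \<in> dom \<Gamma>" "Cur \<in> dom \<Gamma>"
    using P(2) Q(1) assms(2,3) by (auto dest: vle_in_vget vle_in_dom Cur_in_dom_if_vget)
  then have sub: "vget \<Gamma> (Nm a) \<subseteq> vget \<Gamma> Cur" using assms(1) unfolding visibility_iff by blast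
  have le: "dom \<Gamma>\<^sub>1 \<subseteq> dom \<Gamma>" "dom \<Gamma>\<^sub>2 \<subseteq> dom \<Gamma>" "\<And>p. vget \<Gamma>\<^sub>1 p \<subseteq> vget \<Gamma> p" "\<And>p. vget \<Gamma>\<^sub>2 p \<subseteq> vget \<Gamma> p"
    using assms(2,3) by (auto simp: vle_def)
  have fresh: "vget \<Gamma> (Nm b) = {}" using assms(5) by (auto simp: vnames_iff vget_notin_dom)
  \<comment> \<open>Control leaves through \<open>b\<close> and comes straight back through
    \<open>b\<close>: afterwards \<open>Cur\<close> and \<open>b\<close> both see what the sender
    saw, together with \<open>b\<close>. This bounds the visibility of both residuals, and erasing
    \<open>b\<close> leads back below \<Gamma>.\<close>
  define \<Gamma>' where "\<Gamma>' = vis_in (vis_out \<Gamma> b) b b"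
  have dom: "dom \<Gamma>' = insert (Nm b) (dom \<Gamma>)" using a by (auto simp: \<Gamma>'_def)
  have get: "vget \<Gamma>' p = (if p = Cur \<or> p = Nm b then insert b (vget \<Gamma> Cur) else vget \<Gamma> p)" for p
    by (simp add: \<Gamma>'_def)
  have "visibility \<Gamma>'" unfolding \<Gamma>'_def
    using assms(1,5) by (intro visibility_vis_in visibility_vis_out) auto
  moreover have "vle (vis_in \<Gamma>\<^sub>1 a b) \<Gamma>'"
    unfolding vle_def
  proof (intro conjI allI)
    show "dom (vis_in \<Gamma>\<^sub>1 a b) \<subseteq> dom \<Gamma>'" using le(1) a(3) by (auto simp: dom)
    show "vget (vis_in \<Gamma>\<^sub>1 a b) p \<subseteq> vget \<Gamma>' p" for p
      using le(3)[of "Nm a"] le(3)[of "Nm b"] le(3)[of p] sub fresh by (auto simp: get)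
  qed
  moreover have "vle (vis_out \<Gamma>\<^sub>2 b) \<Gamma>'"
    unfolding vle_def
  proof (intro conjI allI)
    show "dom (vis_out \<Gamma>\<^sub>2 b) \<subseteq> dom \<Gamma>'" using le(2) by (auto simp: dom)
    show "vget (vis_out \<Gamma>\<^sub>2 b) p \<subseteq> vget \<Gamma>' p" for p
      using le(4)[of Cur] le(4)[of "Nm b"] le(4)[of p] fresh by (auto simp: get)
  qed
  moreover have "Cur \<notin> dom (vis_in \<Gamma>\<^sub>1 a b) \<inter> dom (vis_out \<Gamma>\<^sub>2 b)" by simp
  ultimately have "wt \<Gamma>' (Par P' Q')" using P Q by (auto intro: wt_par)
  moreover have "vle (verase \<Gamma>' (Nm b)) \<Gamma>"
    by (auto simp: vle_def dom get)
  ultimately show "wt \<Gamma> (nuH b (Par P' Q'))" "wt \<Gamma> (nuH b (Par Q' P'))"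
    using assms(5) by (blast intro: wt_nuH wt_par_sym)+
qed

lemma nuH_Par_alpha:
  assumes "b' \<notin> fhn P \<or> b' = b" "b' \<notin> fhn Q \<or> b' = b"
  shows "nuH b (Par P Q) = nuH b' (Par (ren (transpose b b') P) (ren (transpose b b') Q))"
  using assms nuH_alpha[of b' "Par P Q" b] by auto

text \<open>The transmitted name ends up restricted, so both partners can be rebound to a common
  fresh name without changing the resulting process. The two equations serve the two orders of the
  components.\<close>

lemma step_comm_rebind:
  assumes "step I P (AInH a v b) P'" "step I Q (AOutH a v b) Q'"
    "b' \<notin> fhn P" "b' \<notin> fhn Q"
  obtains P'' Q'' where "step I P (AInH a v b') P''" "step I Q (AOutH a v b') Q''"
    "nuH b (Par P' Q') = nuH b' (Par P'' Q'')" "nuH b (Par Q' P') = nuH b' (Par Q'' P'')"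
proof -
  have "b' \<notin> fhn P' \<or> b' = b" "b' \<notin> fhn Q' \<or> b' = b"
    using step_fhn[OF assms(1)] step_fhn[OF assms(2)] assms(3,4) by auto
  then show ?thesis
    using that[OF step_rebind[OF assms(1) _ assms(3), of b, simplified]
        step_rebind[OF assms(2) _ assms(4), of b, simplified]] nuH_Par_alpha
    by metis
qed

text \<open>The step of a restriction of a first-order name refers to an arbitrary choice of this name. The
  induction therefore covers all images under \<open>map_focc\<close> uniformly.\<close>

lemma wt_step_map_focc:
  "wt \<Gamma> R \<Longrightarrow> \<exists>A. finite A \<and> (\<forall>f \<mu> R'. step I (map_focc f 0 R) \<mu> R' \<longrightarrow>
     set (act_bhn \<mu>) \<inter> A = {} \<longrightarrow> wt_after \<Gamma> \<mu> R')"
proof (induction rule: wt.induct)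
  case (wt_outH \<Gamma> a b P e)
  have "wt_after \<Gamma> \<mu> R'"
    if step: "step I (outH a e b (map_focc f 0 P)) \<mu> R'" and fresh: "set (act_bhn \<mu>) \<inter> vnames \<Gamma> = {}"
    for f \<mu> R'
    using step
  proof (cases rule: step_outHE)
    case (1 b')
    then show ?thesis using wt_vis_out_rename[OF wt_map_focc[OF wt_outH.hyps(4)]] wt_outH.hyps fresh
      by simp
  qed
  then show ?case using wt_outH.hyps
    by (intro exI[of _ "vnames \<Gamma>"]) (auto simp: finite_vnames map_focc_binders)
next
  case (wt_inH \<Gamma> a b P x)
  have "wt_after \<Gamma> \<mu> R'"
    if step: "step I (inH a x b (map_focc f 0 P)) \<mu> R'" and fresh: "set (act_bhn \<mu>) \<inter> vnames \<Gamma> = {}"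
    for f \<mu> R'
    using step
  proof (cases rule: step_inHE)
    case (1 v b')
    then show ?thesis using wt_vis_in_rename[OF wt_map_focc[OF wt_inH.hyps(4)]] wt_inH.hyps fresh
      by (simp add: wt_psubst)
  qed
  then show ?case using wt_inH.hyps
    by (intro exI[of _ "vnames \<Gamma>"]) (auto simp: finite_vnames map_focc_binders)
next
  case (wt_repH \<Gamma> a b P x)
  have "wt_after \<Gamma> \<mu> R'"
    if step: "step I (repH a x b (map_focc f 0 P)) \<mu> R'" and fresh: "set (act_bhn \<mu>) \<inter> vnames \<Gamma> = {}"
    for f \<mu> R'
    using step
  proof (cases rule: step_repHE)
    case (1 v b')
    have *: "vle \<Gamma> \<Gamma>" for \<Gamma> by (simp add: vle_def)
    have wt: "wt (vis_in \<Gamma> a b) (map_focc f 0 P)" by (rule wt_map_focc) (rule wt_repH.hyps)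
    \<comment> \<open>The new copy gets the updated visibility and the replica keeps \<Gamma>, which
      does not contain \<open>Cur\<close>.\<close>
    have "wt (vis_in \<Gamma> a b') R'" if "Cur \<notin> dom \<Gamma>"
      unfolding 1(4)
    proof (rule wt_par[of _ "vis_in \<Gamma> a b'" \<Gamma>])
      show "wt (vis_in \<Gamma> a b') (psubst x v (ren (transpose b b') (map_focc f 0 P)))"
        using wt_vis_in_rename[OF wt] wt_repH.hyps 1(1) fresh by (simp add: wt_psubst)
    qed (use that wt wt_repH.hyps 1(1) fresh in
        \<open>auto intro: visibility_vis_in * vle_vis_in_passive wt.wt_repH\<close>)
    then show ?thesis using 1(1) wt_repH.hyps by simp
  qed
  then show ?case using wt_repH.hyps
    by (intro exI[of _ "vnames \<Gamma>"]) (auto simp: finite_vnames map_focc_binders)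
next
  case (wt_nuH \<Gamma>\<^sub>0 P a \<Gamma>)
  then obtain A where A: "finite A" "\<And>f \<mu> R'. step I (map_focc f 0 P) \<mu> R' \<Longrightarrow> set (act_bhn \<mu>) \<inter> A = {} \<Longrightarrow>
    wt_after \<Gamma>\<^sub>0 \<mu> R'" by blast
  have "wt_after \<Gamma> \<mu> R'"
    if step: "step I (nuH a (map_focc f 0 P)) \<mu> R'" and fresh: "set (act_bhn \<mu>) \<inter> insert a A = {}"
    for f \<mu> R'
  proof -
    from step_nuHE[OF step] fresh obtain P'
      where P': "step I (map_focc f 0 P) \<mu> P'" "R' = nuH a P'" by blast
    have wt: "wt_after \<Gamma>\<^sub>0 \<mu> P'" using A(2)[OF P'(1)] fresh by auto
    have a: "a \<notin> act_fhn \<mu>" using step_fhn[OF step] by auto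
    have le: "dom \<Gamma>\<^sub>0 - {Nm a} \<subseteq> dom \<Gamma>" "\<And>p. p \<noteq> Nm a \<Longrightarrow> vget \<Gamma>\<^sub>0 p - {a} \<subseteq> vget \<Gamma> p"
      using wt_nuH.hyps(3) by (auto simp: vle_def split: if_splits)
    show ?thesis
    proof (cases \<mu>)
      case (AInH c v b)
      have "Nm c \<in> dom \<Gamma> \<and> wt (vis_in \<Gamma> c b) (nuH a P')" if "Cur \<notin> dom \<Gamma>"
      proof -
        have *: "Nm c \<in> dom \<Gamma>\<^sub>0" "wt (vis_in \<Gamma>\<^sub>0 c b) P'" using that le(1) wt AInH by auto
        have "vle (verase (vis_in \<Gamma>\<^sub>0 c b) (Nm a)) (vis_in \<Gamma> c b)"
          using le(1) le(2)[of "Nm c"] le(2) a AInH by (fastforce simp: vle_def)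
        moreover have "a \<notin> vnames (vis_in \<Gamma> c b)"
          using vnames_vis_in[of \<Gamma> c b] wt_nuH.hyps(2) fresh AInH by auto
        ultimately show ?thesis using * le(1) a AInH by (auto intro: wt.wt_nuH)
      qed
      then show ?thesis using AInH P' by simp
    next
      case (AOutH c v b)
      have *: "c \<in> vget \<Gamma>\<^sub>0 Cur" "wt (vis_out \<Gamma>\<^sub>0 b) P'" using wt AOutH by auto
      have "vle (verase (vis_out \<Gamma>\<^sub>0 b) (Nm a)) (vis_out \<Gamma> b)"
        using le(1) le(2)[of Cur] le(2) a AOutH by (fastforce simp: vle_def)
      moreover have "a \<notin> vnames (vis_out \<Gamma> b)"
        using vnames_vis_out[of \<Gamma> b] wt_nuH.hyps(2) fresh AOutH by auto
      ultimately show ?thesis using * le(2)[of Cur] a AOutH P' by (auto intro: wt.wt_nuH)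
    qed (use wt P' le(1) wt_nuH.hyps in \<open>auto intro: wt.wt_nuH\<close>)
  qed
  with A(1) show ?case by (intro exI[of _ "insert a A"]) (auto simp: map_focc_binders)
next
  case (wt_ResF \<Gamma> P)
  then obtain A where A: "finite A" "\<And>f \<mu> R'. step I (map_focc f 0 P) \<mu> R' \<Longrightarrow> set (act_bhn \<mu>) \<inter> A = {} \<Longrightarrow>
    wt_after \<Gamma> \<mu> R'" by blast
  have "wt_after \<Gamma> \<mu> R'"
    if step: "step I (ResF (map_focc f 1 P)) \<mu> R'" and fresh: "set (act_bhn \<mu>) \<inter> A = {}" for f \<mu> R'
    using step
  proof (cases rule: step_ResFE)
    case (1 h P\<^sub>0 P\<^sub>0')
    \<comment> \<open>Opening the body with the name chosen by the derivation gives another image of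
      \<open>P\<close> under \<open>map_focc\<close>, to which the induction hypothesis
      applies.\<close>
    have "P\<^sub>0 = map_focc (\<lambda>i. open_occ i h \<circ> f (i + 1)) 0 P"
      using arg_cong[OF 1(1), of "map_focc (\<lambda>k. open_occ k h) 0"]
        map_focc_comp[of "\<lambda>k. open_occ k h" 0 f 1 P] by (simp add: open_occ_closeF)
    then have "wt_after \<Gamma> \<mu> P\<^sub>0'" using A(2) 1(2) fresh by blast
    then show ?thesis unfolding 1(3) nuF_def closeF_eq_map_focc
      by (cases \<mu>) (simp_all add: wt.wt_ResF wt_map_focc)
  qed
  with A(1) show ?case by auto
next
  case (wt_sum \<Gamma> P\<^sub>1 P\<^sub>2)
  then obtain A B where "finite A" "finite B"
    "\<And>f \<mu> R'. step I (map_focc f 0 P\<^sub>1) \<mu> R' \<Longrightarrow> set (act_bhn \<mu>) \<inter> A = {} \<Longrightarrow> wt_after \<Gamma> \<mu> R'"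
    "\<And>f \<mu> R'. step I (map_focc f 0 P\<^sub>2) \<mu> R' \<Longrightarrow> set (act_bhn \<mu>) \<inter> B = {} \<Longrightarrow> wt_after \<Gamma> \<mu> R'"
    by blast
  then show ?case by (intro exI[of _ "A \<union> B"]) (auto simp: Int_Un_distrib elim!: step_SumE)
next
  case (wt_if \<Gamma> P\<^sub>1 P\<^sub>2 e f)
  then obtain A B where "finite A" "finite B"
    "\<And>f \<mu> R'. step I (map_focc f 0 P\<^sub>1) \<mu> R' \<Longrightarrow> set (act_bhn \<mu>) \<inter> A = {} \<Longrightarrow> wt_after \<Gamma> \<mu> R'"
    "\<And>f \<mu> R'. step I (map_focc f 0 P\<^sub>2) \<mu> R' \<Longrightarrow> set (act_bhn \<mu>) \<inter> B = {} \<Longrightarrow> wt_after \<Gamma> \<mu> R'"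
    by blast
  then show ?case by (intro exI[of _ "A \<union> B"]) (auto simp: Int_Un_distrib elim!: step_IfEqE)
next
  case (wt_par \<Gamma> \<Gamma>\<^sub>1 \<Gamma>\<^sub>2 P\<^sub>1 P\<^sub>2)
  then obtain A B where A: "finite A" "finite B"
    "\<And>f \<mu> R'. step I (map_focc f 0 P\<^sub>1) \<mu> R' \<Longrightarrow> set (act_bhn \<mu>) \<inter> A = {} \<Longrightarrow> wt_after \<Gamma>\<^sub>1 \<mu> R'"
    "\<And>f \<mu> R'. step I (map_focc f 0 P\<^sub>2) \<mu> R' \<Longrightarrow> set (act_bhn \<mu>) \<inter> B = {} \<Longrightarrow> wt_after \<Gamma>\<^sub>2 \<mu> R'"
    by blast
  have fin: "finite (vnames \<Gamma>)" using wt_par.hyps(1) by (rule finite_vnames)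
  \<comment> \<open>Communications are moved to this name, since both induction hypotheses speak
    only of bound names outside \<open>A\<close> and \<open>B\<close>.\<close>
  obtain b' where b': "b' \<notin> A \<union> B \<union> vnames \<Gamma> \<union> fhn P\<^sub>1 \<union> fhn P\<^sub>2"
    using ex_new_if_finite[of "A \<union> B \<union> vnames \<Gamma> \<union> fhn P\<^sub>1 \<union> fhn P\<^sub>2"] A(1,2) fin by auto
  have disj: "Cur \<notin> dom \<Gamma>\<^sub>2 \<inter> dom \<Gamma>\<^sub>1" using wt_par.hyps(4) by auto
  have "wt_after \<Gamma> \<mu> R'"
    if step: "step I (Par (map_focc f 0 P\<^sub>1) (map_focc f 0 P\<^sub>2)) \<mu> R'"
      and fresh: "set (act_bhn \<mu>) \<inter> (A \<union> B \<union> vnames \<Gamma>) = {}" for f \<mu> R'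
    using step
  proof (cases rule: step_ParE)
    case (commH1 a v b P' Q')
    have fr: "b' \<notin> fhn (map_focc f 0 P\<^sub>1)" "b' \<notin> fhn (map_focc f 0 P\<^sub>2)" using b' by auto
    obtain P'' Q'' where
      *: "step I (map_focc f 0 P\<^sub>1) (AInH a v b') P''" "step I (map_focc f 0 P\<^sub>2) (AOutH a v b') Q''" 
        "R' = nuH b' (Par P'' Q'')"
      using step_comm_rebind[OF commH1(3,4) fr] commH1(2) by metis
    have "wt_after \<Gamma>\<^sub>1 (AInH a v b') P''" "wt_after \<Gamma>\<^sub>2 (AOutH a v b') Q''"
      using A(3)[OF *(1)] A(4)[OF *(2)] b' by auto
    then show ?thesis using wt_comm(1)[OF wt_par.hyps(1-4)] b' *(3) commH1(1) by auto
  next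
    case (commH2 a v b P' Q')
    have fr: "b' \<notin> fhn (map_focc f 0 P\<^sub>2)" "b' \<notin> fhn (map_focc f 0 P\<^sub>1)" using b' by auto
    obtain P'' Q'' where
      *: "step I (map_focc f 0 P\<^sub>1) (AOutH a v b') P''" "step I (map_focc f 0 P\<^sub>2) (AInH a v b') Q''" 
        "R' = nuH b' (Par P'' Q'')"
      using step_comm_rebind[OF commH2(4,3) fr] commH2(2) by metis
    have "wt_after \<Gamma>\<^sub>1 (AOutH a v b') P''" "wt_after \<Gamma>\<^sub>2 (AInH a v b') Q''"
      using A(3)[OF *(1)] A(4)[OF *(2)] b' by auto
    then show ?thesis using wt_comm(2)[OF wt_par.hyps(1,3,2) disj] b' *(3) commH2(1) by auto
  next
    case (commF1 h v P' Q')
    then show ?thesis using A(3)[OF commF1(3)] A(4)[OF commF1(4)] wt_par.hyps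
      by (auto intro: wt.wt_par)
  next
    case (commF2 h v P' Q')
    then show ?thesis using A(3)[OF commF2(3)] A(4)[OF commF2(4)] wt_par.hyps
      by (auto intro: wt.wt_par)
  next
    case (par1 P')
    have "wt_after \<Gamma>\<^sub>1 \<mu> P'" using A(3)[OF par1(2)] fresh by auto
    then show ?thesis unfolding par1 using fresh wt_par.hyps wt_map_focc[OF wt_par.hyps(6)]
      by (intro wt_after_par1) auto
  next
    case (par2 Q')
    have "wt_after \<Gamma>\<^sub>2 \<mu> Q'" using A(4)[OF par2(2)] fresh by auto
    then have "wt_after \<Gamma> \<mu> (Par Q' (map_focc f 0 P\<^sub>1))"
      using fresh wt_par.hyps disj wt_map_focc[OF wt_par.hyps(5)]
      by (intro wt_after_par1[of \<Gamma>\<^sub>2 _ _ _ \<Gamma>\<^sub>1]) auto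
    then show ?thesis unfolding par2 by (cases \<mu>) (auto intro: wt_par_sym)
  qed
  with A(1,2) fin show ?case by (intro exI[of _ "A \<union> B \<union> vnames \<Gamma>"]) auto
next
  case (wt_outF \<Gamma> P u e)
  then show ?case by (intro exI[of _ "{}"]) (auto elim!: step_OutFE intro: wt_map_focc)
next
  case (wt_inF \<Gamma> P u x)
  then show ?case by (intro exI[of _ "{}"]) (auto elim!: step_InFE intro!: wt_psubst wt_map_focc)
next
  case (wt_succ \<Gamma> w P)
  then show ?case by (intro exI[of _ "{}"]) (auto elim!: step_SuccE)
next
  case (wt_null \<Gamma>)
  then show ?case by (intro exI[of _ "{}"]) (auto simp: step_NullE)
qed

corollary wt_step:
  assumes "wt \<Gamma> R"
  obtains A where "finite A"
    "\<And>\<mu> R'. step I R \<mu> R' \<Longrightarrow> set (act_bhn \<mu>) \<inter> A = {} \<Longrightarrow> wt_after \<Gamma> \<mu> R'"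
proof -
  have "map_focc (\<lambda>_ u. u) k R = R" for k by (induction R arbitrary: k) auto
  with wt_step_map_focc[OF assms] that show ?thesis by metis
qed

section \<open>From traces to tests\<close>

text \<open>The steps are counted because the inductions below are on the length of a computation:
  stripping the restriction left by a communication preserves this number.\<close>

inductive succ_in :: "('f \<Rightarrow> 'v list \<Rightarrow> 'v) \<Rightarrow> nat \<Rightarrow> ('f, 'v) proc \<Rightarrow> sname \<Rightarrow> bool"
  for I :: "'f \<Rightarrow> 'v list \<Rightarrow> 'v"
where
  succ_now: "step I P (ASucc w) P' \<Longrightarrow> succ_in I 0 P w"
| succ_tau: "step I P Tau P' \<Longrightarrow> succ_in I n P' w \<Longrightarrow> succ_in I (Suc n) P w"

lemma may_succeed_tau: "step I P Tau P' \<Longrightarrow> may_succeed I P' w \<Longrightarrow> may_succeed I P w"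
  unfolding may_succeed_def by (meson converse_rtranclp_into_rtranclp)

lemma may_succeed_now: "step I P (ASucc w) P' \<Longrightarrow> may_succeed I P w"
  unfolding may_succeed_def by blast

lemma may_succeed_iff_succ_in: "may_succeed I P w \<longleftrightarrow> (\<exists>n. succ_in I n P w)"
proof
  assume "may_succeed I P w"
  then obtain P' P'' where "(\<lambda>R R'. step I R Tau R')\<^sup>*\<^sup>* P P'" "step I P' (ASucc w) P''"
    unfolding may_succeed_def by blast
  then show "\<exists>n. succ_in I n P w"
    by (induction rule: converse_rtranclp_induct) (blast intro: succ_in.intros)+
next
  have "succ_in I n P w \<Longrightarrow> may_succeed I P w" for n
    by (induction rule: succ_in.induct) (auto intro: may_succeed_now may_succeed_tau)
  then show "\<exists>n. succ_in I n P w \<Longrightarrow> may_succeed I P w" by blast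
qed

lemma succ_in_nuH: "succ_in I n (nuH b P) w \<Longrightarrow> succ_in I n P w"
proof (induction n arbitrary: P)
  case 0
  then obtain Q where "step I (nuH b P) (ASucc w) Q" by (auto elim: succ_in.cases)
  then show ?case by (auto elim!: step_nuHE intro: succ_in.intros)
next
  case (Suc n)
  then obtain Q where "step I (nuH b P) Tau Q" "succ_in I n Q w" by (auto elim: succ_in.cases)
  moreover from this obtain P' where "step I P Tau P'" "Q = nuH b P'" by (auto elim!: step_nuHE)
  ultimately show ?case using Suc.IH by (auto intro: succ_in.intros)
qed

lemma may_succeed_nuH: "may_succeed I P w \<Longrightarrow> may_succeed I (nuH b P) w"
proof -
  have "succ_in I n P w \<Longrightarrow> succ_in I n (nuH b P) w" for n
  proof (induction rule: succ_in.induct)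
    case (succ_now P w P')
    then show ?case using step_nuH[OF succ_now, of b] by (auto intro: succ_in.intros)
  next
    case (succ_tau P P' n w)
    then show ?case using step_nuH[OF succ_tau.hyps(1), of b] by (auto intro: succ_in.intros)
  qed
  then show "may_succeed I P w \<Longrightarrow> may_succeed I (nuH b P) w" by (auto simp: may_succeed_iff_succ_in)
qed

section \<open>The two halves of a computation: tester and tested process\<close>

primrec dual :: "'v action \<Rightarrow> 'v action" where
  "dual Tau = Tau"
| "dual (AInH a v b) = AOutH a v b"
| "dual (AOutH a v b) = AInH a v b"
| "dual (AInF h v) = AOutF h v"
| "dual (AOutF h v) = AInF h v"
| "dual (ASucc w) = ASucc w"

text \<open>The tester's half of a successful computation; \<open>runs\<close> is the half of the
  tested process and carries the visibility conditions for both.\<close>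

inductive accepts :: "('f \<Rightarrow> 'v list \<Rightarrow> 'v) \<Rightarrow> ('f, 'v) proc \<Rightarrow> 'v action list \<Rightarrow> sname \<Rightarrow> bool"
  for I :: "'f \<Rightarrow> 'v list \<Rightarrow> 'v"
where
  accepts_succ: "step I R (ASucc w) R' \<Longrightarrow> accepts I R [] w"
| accepts_tau: "step I R Tau R' \<Longrightarrow> accepts I R' s w \<Longrightarrow> accepts I R s w"
| accepts_act: "step I R (dual \<mu>) R' \<Longrightarrow> accepts I R' s w \<Longrightarrow> accepts I R (\<mu> # s) w"

definition runs :: "('f \<Rightarrow> 'v list \<Rightarrow> 'v) \<Rightarrow> vis \<Rightarrow> ('f, 'v) proc \<Rightarrow> 'v action list \<Rightarrow> bool" where
  "runs I \<Gamma> P s \<longleftrightarrow> (\<exists>\<Gamma>' P'. tweak_steps I \<Gamma> P s \<Gamma>' P')"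

lemma runs_Nil: "runs I \<Gamma> P []"
  unfolding runs_def by (blast intro: tweak_steps_Nil)

lemma runs_Cons_iff: "runs I \<Gamma> P (\<mu> # s) \<longleftrightarrow>
    (\<exists>P'' \<Gamma>' P''' P'. tweak I \<Gamma> P P'' \<and> tstep I \<Gamma> P'' \<mu> \<Gamma>' P''' \<and> tweak I \<Gamma>' P''' P' \<and> runs I \<Gamma>' P' s)"
    (is "_ \<longleftrightarrow> ?R")
proof
  assume "runs I \<Gamma> P (\<mu> # s)"
  then obtain \<Gamma>'' P'' where "tweak_steps I \<Gamma> P (\<mu> # s) \<Gamma>'' P''" unfolding runs_def by blast
  then show ?R
  proof (cases rule: tweak_steps.cases)
    case (tweak_steps_Cons \<Gamma>' P')
    then show ?thesis unfolding tweak_step_def runs_def by blast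
  qed
next
  assume ?R
  then obtain \<Gamma>' P' where "tweak_step I \<Gamma> P \<mu> \<Gamma>' P'" "runs I \<Gamma>' P' s"
    unfolding tweak_step_def by blast
  then show "runs I \<Gamma> P (\<mu> # s)" unfolding runs_def by (blast intro: tweak_steps_Cons)
qed

lemma runs_act: "tstep I \<Gamma> P \<mu> \<Gamma>' P' \<Longrightarrow> runs I \<Gamma>' P' s \<Longrightarrow> runs I \<Gamma> P (\<mu> # s)"
  unfolding runs_Cons_iff tweak_def by blast

lemma runs_tau: "tstep I \<Gamma> P Tau \<Gamma> P' \<Longrightarrow> runs I \<Gamma> P' s \<Longrightarrow> runs I \<Gamma> P s"
proof (cases s)
  case (Cons \<mu> s')
  then show "tstep I \<Gamma> P Tau \<Gamma> P' \<Longrightarrow> runs I \<Gamma> P' s \<Longrightarrow> runs I \<Gamma> P s"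
    unfolding Cons runs_Cons_iff tweak_def by (meson converse_rtranclp_into_rtranclp)
qed (simp add: runs_Nil)

lemma tstep_step: "tstep I \<Gamma> P \<mu> \<Gamma>' P' \<Longrightarrow> step I P \<mu> P'"
  by (auto elim: tstep.cases)

lemma step_par_unbound:
  "step I P Tau P' \<Longrightarrow> step I (Par P Q) Tau (Par P' Q)"
  "step I Q Tau Q' \<Longrightarrow> step I (Par P Q) Tau (Par P Q')"
  "step I P (ASucc w) P' \<Longrightarrow> step I (Par P Q) (ASucc w) (Par P' Q)"
  by (simp_all add: step_par1 step_par2)

lemma may_succeed_par_tweak:
  "tweak I \<Gamma> Q Q' \<Longrightarrow> may_succeed I (Par R Q') w \<Longrightarrow> may_succeed I (Par R Q) w"
  unfolding tweak_def
  by (induction rule: converse_rtranclp_induct)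
    (auto dest!: tstep_step intro: may_succeed_tau step_par_unbound)

text \<open>No freshness is needed to run \<open>R\<close> and \<open>Q\<close> in lockstep: the restrictions introduced by
  communications do not obstruct internal steps.\<close>

lemma may_succeed_if_accepts:
  "accepts I R s w \<Longrightarrow> runs I \<Gamma> Q s \<Longrightarrow> may_succeed I (Par R Q) w"
proof (induction arbitrary: \<Gamma> Q rule: accepts.induct)
  case (accepts_succ R w R')
  then show ?case by (auto intro: may_succeed_now step_par_unbound)
next
  case (accepts_tau R R' s w)
  then show ?case by (auto intro: may_succeed_tau step_par_unbound)
next
  case (accepts_act R \<mu> R' s w)
  then obtain Q1 \<Gamma>' Q2 Q3 where *: "tweak I \<Gamma> Q Q1" "tstep I \<Gamma> Q1 \<mu> \<Gamma>' Q2" "tweak I \<Gamma>' Q2 Q3"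
    "runs I \<Gamma>' Q3 s" unfolding runs_Cons_iff by blast
  have succ: "may_succeed I (Par R' Q2) w"
    using may_succeed_par_tweak[OF *(3)] accepts_act.IH[OF *(4)] by blast
  have "may_succeed I (Par R Q1) w"
    using *(2)
  proof (cases rule: tstep.cases)
    case (tstep_outH a v b)
    then show ?thesis using accepts_act.hyps(1) succ
      by (auto intro: may_succeed_tau step_commH1 may_succeed_nuH)
  next
    case (tstep_inH a v b)
    then show ?thesis using accepts_act.hyps(1) succ
      by (auto intro: may_succeed_tau step_commH2 may_succeed_nuH)
  next
    case (tstep_outF h v)
    then show ?thesis using accepts_act.hyps(1) succ by (auto intro: may_succeed_tau step_commF1)
  next
    case (tstep_inF h v)
    then show ?thesis using accepts_act.hyps(1) succ by (auto intro: may_succeed_tau step_commF2)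
  next
    case tstep_tau
    then have "step I (Par R Q1) Tau (Par R' Q1)" "step I (Par R' Q1) Tau (Par R' Q2)"
      using accepts_act.hyps(1) by (auto intro: step_par_unbound)
    then show ?thesis using succ by (blast intro: may_succeed_tau)
  qed
  then show ?case using may_succeed_par_tweak[OF *(1)] by blast
qed

lemma trace_bhn_simps [simp]:
  "trace_bhn [] = []" "trace_bhn (\<mu> # s) = act_bhn \<mu> @ trace_bhn s"
  by (simp_all add: trace_bhn_def)

text \<open>Induction on the length of the computation. \<open>A\<close> grows by the name of each
  communication, so the later bound names differ from it; as \<open>fhn P\<close> lies in
  \<open>A\<close>, the bound on \<open>trace_fhn\<close> then yields \<open>is_trace\<close>. The
  premise on \<open>c\<close> keeps the token from being on both sides, and
  \<open>w \<notin> snames P\<close> makes the final success one of the tester.\<close>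

lemma succ_in_par_decompose:
  assumes "succ_in I n (Par R P) w" "wt \<Gamma> R" "cur_typed P c" "c \<Longrightarrow> Cur \<notin> dom \<Gamma>" "w \<notin> snames P"
    "finite A" "vnames \<Gamma> \<subseteq> A" "fhn P \<subseteq> A"
  shows "\<exists>s. runs I \<Gamma> P s \<and> accepts I R s w \<and> Tau \<notin> set s \<and> set (trace_bhn s) \<inter> A = {} \<and>
    distinct (trace_bhn s) \<and> trace_fhn s \<subseteq> fhn P"
  using assms
proof (induction n arbitrary: R P \<Gamma> c A)
  case 0
  then obtain X where "step I (Par R P) (ASucc w) X" by (auto elim: succ_in.cases)
  then obtain R' where "step I R (ASucc w) R'"
    using 0(5) by (cases rule: step_ParE) (auto dest: step_snames)
  then show ?case by (intro exI[of _ "[]"]) (auto intro: runs_Nil accepts_succ)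
next
  case (Suc n)
  from Suc.prems(1) obtain X where X: "step I (Par R P) Tau X" "succ_in I n X w"
    by (auto elim: succ_in.cases)
  from wt_step[OF Suc.prems(2), of I] obtain B where B: "finite B"
    "\<And>\<mu> R'. step I R \<mu> R' \<Longrightarrow> set (act_bhn \<mu>) \<inter> B = {} \<Longrightarrow> wt_after \<Gamma> \<mu> R'" by blast
  \<comment> \<open>Besides the names to be avoided by the trace, \<open>b'\<close> also avoids
    \<open>B\<close>, outside of which the residuals of \<open>R\<close> are typed.\<close>
  obtain b' where "b' \<notin> A \<union> B \<union> fhn R \<union> fhn P"
    using ex_new_if_finite[of "A \<union> B \<union> fhn R \<union> fhn P"] B(1) Suc.prems(6) by auto
  then have b': "b' \<notin> A" "b' \<notin> B" "b' \<notin> fhn R" "b' \<notin> fhn P" "b' \<notin> vnames \<Gamma>"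
    using Suc.prems(7) by auto
  \<comment> \<open>Common end of the four communication cases: the induction hypothesis is used
    with the new bound name added to \<open>A\<close>, and the action is put in front of the
    trace.\<close>
  have act: ?case
    if R: "step I R (dual \<mu>) R'" "wt \<Gamma>' R'" and P: "step I P \<mu> P'" "tstep I \<Gamma> P \<mu> \<Gamma>' P'" "cur_typed P' c'"
      and c': "c' \<Longrightarrow> Cur \<notin> dom \<Gamma>'" and \<mu>: "\<mu> \<noteq> Tau" "set (act_bhn \<mu>) \<subseteq> {b'}"
      and \<Gamma>': "vnames \<Gamma>' \<subseteq> vnames \<Gamma> \<union> set (act_bhn \<mu>)" and succ: "succ_in I n (Par R' P') w"
    for \<mu> R' P' \<Gamma>' c'
  proof -
    have "w \<notin> snames P'" using step_snames[OF P(1)] Suc.prems(5) by auto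
    moreover have "vnames \<Gamma>' \<subseteq> A \<union> set (act_bhn \<mu>)" "fhn P' \<subseteq> A \<union> set (act_bhn \<mu>)"
      using \<Gamma>' step_fhn[OF P(1)] Suc.prems(7,8) by auto
    ultimately obtain s where s: "runs I \<Gamma>' P' s" "accepts I R' s w" "Tau \<notin> set s"
      "set (trace_bhn s) \<inter> (A \<union> set (act_bhn \<mu>)) = {}" "distinct (trace_bhn s)" "trace_fhn s \<subseteq> fhn P'"
      using Suc.IH[OF succ R(2) P(3) c', of "A \<union> set (act_bhn \<mu>)"] Suc.prems(6) by auto
    have "distinct (act_bhn \<mu>)" by (cases \<mu>) auto
    then have "distinct (trace_bhn (\<mu> # s))" using s(4,5) by auto
    moreover have "set (trace_bhn (\<mu> # s)) \<inter> A = {}" using s(4) \<mu>(2) b'(1) by auto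
    moreover have "trace_fhn (\<mu> # s) \<subseteq> fhn P" using s(6) step_fhn[OF P(1)] by auto
    ultimately show ?thesis using s R P \<mu>(1) by (intro exI[of _ "\<mu> # s"]) (auto intro: runs_act accepts_act)
  qed
  from X(1) show ?case
  proof (cases rule: step_ParE)
    case (commH1 a v b R\<^sub>0 P\<^sub>0)
    from step_comm_rebind[OF commH1(3,4) b'(3,4)] commH1(2) obtain R' P' where
      *: "step I R (AInH a v b') R'" "step I P (AOutH a v b') P'" "X = nuH b' (Par R' P')" by metis
    have c: "c" "cur_typed P' False" using step_cur_typed[OF *(2) Suc.prems(3)] by auto
    then have cur: "Cur \<notin> dom \<Gamma>" using Suc.prems(4) by simp
    have wt: "Nm a \<in> dom \<Gamma>" "wt (vis_in \<Gamma> a b') R'" using B(2)[OF *(1)] b' cur by auto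
    have "succ_in I n (Par R' P') w" using X(2) *(3) by (auto intro: succ_in_nuH)
    moreover have "tstep I \<Gamma> P (AOutH a v b') (vis_in \<Gamma> a b') P'"
      unfolding vis_in_def using *(2) wt(1) cur b'(5) by (rule tstep_outH)
    ultimately show ?thesis
      using act[of "AOutH a v b'" R' "vis_in \<Gamma> a b'" P' False] * wt c vnames_vis_in[of \<Gamma> a b'] by auto
  next
    case (commH2 a v b R\<^sub>0 P\<^sub>0)
    from step_comm_rebind[OF commH2(4,3) b'(4,3)] commH2(2) obtain R' P' where
      *: "step I R (AOutH a v b') R'" "step I P (AInH a v b') P'" "X = nuH b' (Par R' P')" by metis
    have wt: "a \<in> vget \<Gamma> Cur" "wt (vis_out \<Gamma> b') R'" using B(2)[OF *(1)] b' by auto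
    then have "\<not> c" using Suc.prems(4) Cur_in_dom_if_vget by auto
    then have c: "cur_typed P' True" using step_cur_typed[OF *(2) Suc.prems(3)] by auto
    have "succ_in I n (Par R' P') w" using X(2) *(3) by (auto intro: succ_in_nuH)
    moreover have "tstep I \<Gamma> P (AInH a v b') (vis_out \<Gamma> b') P'"
      unfolding vis_out_def using *(2) wt(1) b'(5) by (rule tstep_inH)
    ultimately show ?thesis
      using act[of "AInH a v b'" R' "vis_out \<Gamma> b'" P' True] * wt c vnames_vis_out[of \<Gamma> b'] by auto
  next
    case (commF1 h v R' P')
    have wt: "Cur \<in> dom \<Gamma>" "wt \<Gamma> R'" using B(2)[OF commF1(3)] by auto
    then have c: "cur_typed P' False"
      using step_cur_typed[OF commF1(4) Suc.prems(3)] Suc.prems(4) by (cases c) auto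
    have "tstep I \<Gamma> P (AOutF h v) \<Gamma> P'" using commF1(4) wt(1) by (rule tstep_outF)
    then show ?thesis using act[of "AOutF h v" R' \<Gamma> P' False] commF1 wt c X(2) by auto
  next
    case (commF2 h v R' P')
    have wt: "wt \<Gamma> R'" using B(2)[OF commF2(3)] by auto
    have c: "cur_typed P' True" "c" using step_cur_typed[OF commF2(4) Suc.prems(3)] by auto
    then have cur: "Cur \<notin> dom \<Gamma>" using Suc.prems(4) by simp
    have "tstep I \<Gamma> P (AInF h v) \<Gamma> P'" using commF2(4) cur by (rule tstep_inF)
    then show ?thesis using act[of "AInF h v" R' \<Gamma> P' True] commF2 wt c cur X(2) by auto
  next
    case (par1 R')
    have "wt \<Gamma> R'" using B(2)[OF par1(2)] by auto
    then obtain s where "runs I \<Gamma> P s" "accepts I R' s w" "Tau \<notin> set s" "set (trace_bhn s) \<inter> A = {}"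
      "distinct (trace_bhn s)" "trace_fhn s \<subseteq> fhn P"
      using Suc.IH[of R' P \<Gamma> c A] Suc.prems X(2) par1(1) by auto
    then show ?thesis using par1(2) by (blast intro: accepts_tau)
  next
    case (par2 P')
    have c: "c" "cur_typed P' True" using step_cur_typed[OF par2(2) Suc.prems(3)] by auto
    then have cur: "Cur \<notin> dom \<Gamma>" using Suc.prems(4) by simp
    have fhn: "fhn P' \<subseteq> fhn P" "w \<notin> snames P'"
      using step_fhn[OF par2(2)] step_snames[OF par2(2)] Suc.prems(5) by auto
    have "tstep I \<Gamma> P Tau \<Gamma> P'" using par2(2) cur by (rule tstep_tau)
    moreover obtain s where "runs I \<Gamma> P' s" "accepts I R s w" "Tau \<notin> set s" "set (trace_bhn s) \<inter> A = {}"
      "distinct (trace_bhn s)" "trace_fhn s \<subseteq> fhn P'"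
      using Suc.IH[of R P' \<Gamma> True A] Suc.prems X(2) par2(1) c cur fhn by auto
    ultimately show ?thesis using fhn(1) by (blast intro: runs_tau)
  qed
qed

lemma may_succeed_transfer:
  assumes "\<And>s. set (trace_bhn s) \<inter> A = {} \<Longrightarrow> trace_of I \<Gamma> P s \<Longrightarrow> trace_of I \<Gamma> Q s"
    and "finite A" "fhn P \<subseteq> A" "vnames \<Gamma> \<subseteq> A"
    and "\<Delta> \<turnstile> P" "compatible \<Delta> \<Gamma>" "\<Gamma> \<turnstile> R" "w \<notin> snames P" "may_succeed I (Par R P) w"
  shows "may_succeed I (Par R Q) w"
proof -
  obtain n where "succ_in I n (Par R P) w" using assms(9) by (auto simp: may_succeed_iff_succ_in)
  moreover have "Cur \<in> dom \<Delta> \<Longrightarrow> Cur \<notin> dom \<Gamma>" using assms(6) by (auto simp: compatible_def)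
  ultimately obtain s where s: "runs I \<Gamma> P s" "accepts I R s w" "Tau \<notin> set s"
    "set (trace_bhn s) \<inter> A = {}" "distinct (trace_bhn s)" "trace_fhn s \<subseteq> fhn P"
    using succ_in_par_decompose[OF _ typed_wt[OF assms(7)] typed_cur_typed[OF assms(5)], of I n w A]
      assms by blast
  then have "trace_of I \<Gamma> P s"
    using assms(3) by (auto simp: trace_of_def is_trace_def runs_def)
  then have "runs I \<Gamma> Q s" using assms(1) s(4) by (auto simp: trace_of_def runs_def)
  then show ?thesis using may_succeed_if_accepts s(2) by blast
qed

section \<open>From tests to traces\<close>

text \<open>The success name \<open>Suc w\<close> only marks failure: unlike \<open>Null\<close>, a success prefix is typed also in
  the presence of \<open>Cur\<close>.\<close>

definition check :: "sname \<Rightarrow> 'v \<Rightarrow> ('f, 'v) proc \<Rightarrow> ('f, 'v) proc" where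
  "check w v P = IfEq (Var 0) (Val v) P (Succ (Suc w) Null)"

text \<open>Binders of the tester are the bound names of the trace, so later actions can use them as
  subjects. Variable 0 serves for every input because the rest of the tester is closed. The default
  \<open>Null\<close> concerns \<open>Tau\<close> and success actions; the former is excluded from
  traces, the latter is never type-allowed.\<close>

primrec tester :: "sname \<Rightarrow> 'v action list \<Rightarrow> ('f, 'v) proc" where
  "tester w [] = Succ w Null"
| "tester w (\<mu> # s) = (case \<mu> of
      AOutH a v b \<Rightarrow> inH a 0 b (check w v (tester w s))
    | AInH a v b \<Rightarrow> outH a (Val v) b (tester w s)
    | AOutF h v \<Rightarrow> InF (Free h) 0 (check w v (tester w s))
    | AInF h v \<Rightarrow> OutF (Free h) (Val v) (tester w s)
    | _ \<Rightarrow> Null)"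

lemma closed_at_mono: "closed_at i j X P \<Longrightarrow> X \<subseteq> Y \<Longrightarrow> closed_at i j Y P"
  by (induction P arbitrary: i j X Y) (auto, (meson insert_mono)+)

lemma closed_at_closeH: "closed_at i j X P \<Longrightarrow> k \<le> i \<Longrightarrow> closed_at (Suc i) j X (closeH k b P)"
proof (induction P arbitrary: i j X k)
qed (auto simp: close_occ_def split: occ.splits)

lemma psubst_closed:
  fixes P :: "('f, 'v) proc"
  shows "closed_at i j X P \<Longrightarrow> x \<notin> X \<Longrightarrow> psubst x v P = P"
proof -
  have e: "evars e \<subseteq> X \<Longrightarrow> x \<notin> X \<Longrightarrow> esubst x v e = e" for e :: "('f, 'v) expr" and X
    by (induction e) (auto intro!: map_idI)
  show "closed_at i j X P \<Longrightarrow> x \<notin> X \<Longrightarrow> psubst x v P = P"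
    by (induction P arbitrary: i j X) (auto simp: e)
qed

lemma closed_tester: "closed_at 0 0 {} (tester w s :: ('f, 'v) proc)"
proof (induction s)
  case (Cons \<mu> s)
  have "closed_at 0 0 {0} (check w v (tester w s) :: ('f, 'v) proc)" for v
    using closed_at_mono[OF Cons, of "{0}"] by (simp add: check_def)
  with Cons show ?case
    by (cases \<mu>) (simp_all add: binder_defs closed_at_closeH)
qed simp

lemma psubst_check:
  "psubst 0 v' (check w v (tester w s)) = IfEq (Val v') (Val v) (tester w s) (Succ (Suc w) Null)"
  by (simp add: check_def psubst_closed[OF closed_tester])

text \<open>The run is a certificate: every \<open>tstep\<close> contains the side conditions of the
  typing rule for the complementary prefix and produces the visibility function for its
  continuation.\<close>

lemma typed_tester:
  fixes P :: "('f, 'v) proc"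
  shows "runs I \<Gamma> P s \<Longrightarrow> Tau \<notin> set s \<Longrightarrow> visibility \<Gamma> \<Longrightarrow> \<Gamma> \<turnstile> (tester w s :: ('f, 'v) proc)"
proof (induction s arbitrary: \<Gamma> P)
  case Nil
  then show ?case by (simp add: typed_succ)
next
  case (Cons \<mu> s)
  then obtain P1 \<Gamma>' P2 P3 where *: "tstep I \<Gamma> P1 \<mu> \<Gamma>' P2" "runs I \<Gamma>' P3 s"
    unfolding runs_Cons_iff by blast
  have check: "\<Gamma>'' \<turnstile> check w v Q" if "\<Gamma>'' \<turnstile> Q" "visibility \<Gamma>''"
    for \<Gamma>'' v and Q :: "('f, 'v) proc"
    using that unfolding check_def by (auto intro: typed_if typed_succ)
  from *(1) show ?case
  proof (cases rule: tstep.cases)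
    case (tstep_outH a v b)
    then have \<Gamma>': "\<Gamma>' = vis_in \<Gamma> a b" by (simp only: vis_in_def)
    have vis: "visibility \<Gamma>'" using Cons.prems(3) tstep_outH(6) unfolding \<Gamma>' by (simp add: visibility_vis_in)
    have "\<Gamma>' \<turnstile> check w v (tester w s :: ('f, 'v) proc)"
      by (rule check[OF Cons.IH[OF *(2)] vis]) (use Cons.prems vis in auto)
    then have "\<Gamma> \<turnstile> inH a 0 b (check w v (tester w s :: ('f, 'v) proc))"
      using tstep_outH Cons.prems(3) by (intro typed_inH) (auto simp only:)
    then show ?thesis using tstep_outH by simp
  next
    case (tstep_inH a v b)
    then have \<Gamma>': "\<Gamma>' = vis_out \<Gamma> b" by (simp only: vis_out_def)
    have "visibility \<Gamma>'" using Cons.prems(3) tstep_inH(5) unfolding \<Gamma>' by (simp add: visibility_vis_out)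
    then have "\<Gamma>' \<turnstile> (tester w s :: ('f, 'v) proc)" using Cons *(2) by auto
    then have "\<Gamma> \<turnstile> outH a (Val v) b (tester w s :: ('f, 'v) proc)"
      using tstep_inH Cons.prems(3) by (intro typed_outH) (auto simp only:)
    then show ?thesis using tstep_inH by simp
  next
    case (tstep_outF h v)
    have "\<Gamma> \<turnstile> check w v (tester w s :: ('f, 'v) proc)"
      using check[OF Cons.IH[OF *(2)]] Cons.prems tstep_outF by auto
    then show ?thesis using tstep_outF by (auto intro: typed_inF)
  next
    case (tstep_inF h v)
    then show ?thesis using Cons * by (auto intro: typed_outF)
  next
    case tstep_tau
    then show ?thesis using Cons.prems by auto
  qed
qed

section \<open>The tester succeeds exactly along its trace\<close>

lemma accepts_cong:
  "accepts I T s w \<Longrightarrow> (\<And>\<mu> X. step I T \<mu> X \<Longrightarrow> step I T' \<mu> X) \<Longrightarrow> accepts I T' s w"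
  by (cases rule: accepts.cases) (auto intro: accepts.intros)

lemma accepts_tester: "runs I \<Gamma> P s \<Longrightarrow> Tau \<notin> set s \<Longrightarrow> accepts I (tester w s) s w"
proof (induction s arbitrary: \<Gamma> P)
  case Nil
  then show ?case by (auto intro: accepts_succ step_succ)
next
  case (Cons \<mu> s)
  then obtain P1 \<Gamma>' P2 P3 where *: "tstep I \<Gamma> P1 \<mu> \<Gamma>' P2" "runs I \<Gamma>' P3 s"
    unfolding runs_Cons_iff by blast
  then have acc: "accepts I (tester w s) s w" using Cons by auto
  have check: "accepts I (psubst 0 v (check w v (tester w s))) s w" for v
    unfolding psubst_check by (rule accepts_cong[OF acc]) (auto intro: step_if_true)
  have neq: "act_fhn \<mu> \<inter> set (act_bhn \<mu>) = {}" using *(1) by (blast dest: tstep_step step_bound_neq_subject)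
  from *(1) show ?case
  proof (cases rule: tstep.cases)
    case (tstep_outH a v b)
    then show ?thesis
      using step_inH[of b a I 0 "check w v (tester w s)" v] check neq by (auto intro: accepts_act)
  next
    case (tstep_inH a v b)
    then show ?thesis
      using step_outH[of b a I "Val v" v "tester w s"] acc neq by (auto intro: accepts_act)
  next
    case (tstep_outF h v)
    then show ?thesis
      using step_inF[of I h 0 "check w v (tester w s)" v] check by (auto intro: accepts_act)
  next
    case (tstep_inF h v)
    then show ?thesis
      using step_outF[of I "Val v" v h "tester w s"] acc by (auto intro: accepts_act)
  next
    case tstep_tau
    then show ?thesis using Cons.prems by auto
  qed
qed

text \<open>This is the situation after a failed comparison. \<open>Q\<close> has just output a
  value and is without the token, so it cannot move internally; \<open>X\<close> offers only the
  wrong success, so not even a first step exists.\<close>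

lemma not_succ_in_par_failed:
  assumes "\<And>\<mu> X'. step I X \<mu> X' \<Longrightarrow> \<mu> = ASucc w'" "w' \<noteq> w" "cur_typed Q False" "w \<notin> snames Q"
  shows "\<not> succ_in I n (Par X Q) w"
proof
  assume "succ_in I n (Par X Q) w"
  then obtain \<mu> Y where "step I (Par X Q) \<mu> Y" "\<mu> = Tau \<or> \<mu> = ASucc w" by (auto elim: succ_in.cases)
  then show False using assms
    by (cases rule: step_ParE) (auto dest: step_snames step_cur_typed)
qed

text \<open>After a successful comparison the tester is a conditional that has the steps of the next
  tester without being equal to it; hence the general \<open>X\<close>. The run of \<open>P\<close>
  supplies the visibility functions and side conditions for the typed steps of
  \<open>Q\<close>.\<close>

lemma runs_if_succ_in_tester:
  assumes "succ_in I n (Par X Q) w" "\<And>\<mu> X'. step I X \<mu> X' \<Longrightarrow> step I (tester w s) \<mu> X'"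
    "runs I \<Gamma> P s" "Tau \<notin> set s" "distinct (trace_bhn s)" "set (trace_bhn s) \<inter> fhn Q = {}"
    "w \<notin> snames Q" "cur_typed Q c" "c \<Longrightarrow> Cur \<notin> dom \<Gamma>"
  shows "runs I \<Gamma> Q s"
  using assms
proof (induction n arbitrary: X Q s \<Gamma> P c)
  case 0
  show ?case
  proof (cases s)
    case (Cons \<mu> s')
    from 0(1) obtain Y where "step I (Par X Q) (ASucc w) Y" by (auto elim: succ_in.cases)
    then obtain X' where "step I X (ASucc w) X'"
      using 0(7) by (cases rule: step_ParE) (auto dest: step_snames)
    then have "step I (tester w s) (ASucc w) X'" by (rule 0(2))
    then show ?thesis unfolding Cons
      by (cases \<mu>) (auto simp: step_NullE elim: step_inHE step_outHE step_InFE step_OutFE)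
  qed (simp add: runs_Nil)
next
  case (Suc n)
  show ?case
  proof (cases s)
    case (Cons \<mu> s')
    from Suc.prems(1) obtain Y where Y: "step I (Par X Q) Tau Y" "succ_in I n Y w"
      by (auto elim: succ_in.cases)
    from Suc.prems(3) obtain P1 \<Gamma>' P2 P3 where run: "tstep I \<Gamma> P1 \<mu> \<Gamma>' P2" "runs I \<Gamma>' P3 s'"
      unfolding Cons runs_Cons_iff by blast
    have next_run: "runs I \<Gamma>' Q' s'"
      if "succ_in I n (Par X' Q') w" "step I Q \<mu> Q'" "cur_typed Q' c'" "c' \<Longrightarrow> Cur \<notin> dom \<Gamma>'"
        "\<And>\<nu> X''. step I X' \<nu> X'' \<Longrightarrow> step I (tester w s') \<nu> X''" for X' Q' c'
    proof (rule Suc.IH[OF that(1) that(5) run(2) _ _ _ _ that(3) that(4)])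
      show "set (trace_bhn s') \<inter> fhn Q' = {}"
        using Suc.prems(5,6) step_fhn[OF that(2)] unfolding Cons by auto
      show "w \<notin> snames Q'" using Suc.prems(7) step_snames[OF that(2)] by auto
    qed (use Suc.prems(4,5) Cons in auto)
    have value_ok: "v' = v"
      if "succ_in I n (Par (psubst 0 v' (check w v (tester w s'))) Q') w" "step I Q \<nu> Q'" "cur_typed Q' False"
      for v' v \<nu> Q'
    proof (rule ccontr)
      assume "v' \<noteq> v"
      moreover have "w \<notin> snames Q'" using Suc.prems(7) step_snames[OF that(2)] by auto
      ultimately show False
        using not_succ_in_par_failed[OF _ _ that(3), of I _ "Suc w" w n] that(1) unfolding psubst_check
        by (metis eval.simps(2) n_not_Suc_n step_IfEqE step_SuccE)
    qed
    have check_step: "step I (tester w s') \<nu> X''"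
      if "step I (psubst 0 v (check w v (tester w s'))) \<nu> X''" for v \<nu> X''
      using that unfolding psubst_check by (auto elim: step_IfEqE)
    have X: "step I X \<nu> X' \<Longrightarrow> step I (tester w (\<mu> # s')) \<nu> X'" for \<nu> X'
      using Suc.prems(2) Cons by simp
    have no_tau: "\<not> step I X Tau X'" for X'
      by (rule notI, drule X, cases \<mu>)
        (auto simp: step_NullE elim: step_inHE step_outHE step_InFE step_OutFE)
    have internal: ?thesis if "step I Q Tau Q'" "Y = Par X Q'" for Q'
    proof -
      have c: "c" "cur_typed Q' True" using step_cur_typed[OF that(1) Suc.prems(8)] by auto
      have cur: "Cur \<notin> dom \<Gamma>" using c(1) by (rule Suc.prems(9))
      have "runs I \<Gamma> Q' s"
      proof (rule Suc.IH[OF Y(2)[unfolded that(2)] Suc.prems(2) Suc.prems(3,4,5) _ _ c(2) cur])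
        show "set (trace_bhn s) \<inter> fhn Q' = {}" using Suc.prems(6) step_fhn[OF that(1)] by auto
        show "w \<notin> snames Q'" using Suc.prems(7) step_snames[OF that(1)] by auto
      qed
      then show ?thesis using tstep_tau[OF that(1) cur] by (rule runs_tau[rotated])
    qed
    have neq: "act_fhn \<mu> \<inter> set (act_bhn \<mu>) = {}"
      using run(1) by (blast dest: tstep_step step_bound_neq_subject)
    have fresh: "set (act_bhn \<mu>) \<inter> fhn Q = {}" using Suc.prems(6) Cons by auto
    from run(1) show ?thesis
    proof (cases rule: tstep.cases)
      case (tstep_outH a v b)
      have T: "tester w (\<mu> # s') = inH a 0 b (check w v (tester w s'))" using tstep_outH by simp
      from Y(1) show ?thesis
      proof (cases rule: step_ParE)
        case (commH1 a' v' b' X' Q')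
        have XT: "step I (inH a 0 b (check w v (tester w s'))) (AInH a' v' b') X'"
          using X[OF commH1(3)] unfolding T .
        \<comment> \<open>The communication may have used another name; it is moved to the one in
          the trace, which is bound in the tester, differs from \<open>a\<close>, and is fresh for
          \<open>Q\<close> by assumption.\<close>
        have b: "b \<notin> fhn (inH a 0 b (check w v (tester w s')))" "b \<notin> fhn Q"
          using neq fresh tstep_outH by auto
        obtain X'' Q'' where *: "step I (inH a 0 b (check w v (tester w s'))) (AInH a' v' b) X''"
          "step I Q (AOutH a' v' b) Q''" "Y = nuH b (Par X'' Q'')"
          using step_comm_rebind[OF XT commH1(4) b] commH1(2) by metis
        from *(1) have X'': "a' = a" "X'' = psubst 0 v' (check w v (tester w s'))"
          by (auto elim!: step_inHE simp: ren_idem)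
        have succ: "succ_in I n (Par X'' Q'') w" using Y(2) *(3) by (auto intro: succ_in_nuH)
        have c: "c" "cur_typed Q'' False" using step_cur_typed[OF *(2) Suc.prems(8)] by auto
        have v: "v' = v" using value_ok succ *(2) c(2) X'' by blast
        have Q'': "step I Q \<mu> Q''" using *(2) v X'' tstep_outH by simp
        have "runs I \<Gamma>' Q'' s'"
          by (rule next_run[OF succ Q'' c(2)]) (use check_step v X'' in auto)
        moreover have "tstep I \<Gamma> Q \<mu> \<Gamma>' Q''"
          using tstep_outH Q'' tstep.tstep_outH[of I Q a v b Q'' \<Gamma>] by simp
        ultimately show ?thesis unfolding Cons by (rule runs_act[rotated])
      next
        case (par2 Q')
        then show ?thesis using internal by blast
      qed (use X[unfolded T] no_tau in \<open>auto elim: step_inHE\<close>)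
    next
      case (tstep_inH a v b)
      have T: "tester w (\<mu> # s') = outH a (Val v) b (tester w s')" using tstep_inH by simp
      from Y(1) show ?thesis
      proof (cases rule: step_ParE)
        case (commH2 a' v' b' X' Q')
        have XT: "step I (outH a (Val v) b (tester w s')) (AOutH a' v' b') X'"
          using X[OF commH2(3)] unfolding T .
        have b: "b \<notin> fhn Q" "b \<notin> fhn (outH a (Val v) b (tester w s'))"
          using neq fresh tstep_inH by auto
        obtain X'' Q'' where *: "step I (outH a (Val v) b (tester w s')) (AOutH a' v' b) X''"
          "step I Q (AInH a' v' b) Q''" "Y = nuH b (Par X'' Q'')"
          using step_comm_rebind[OF commH2(4) XT b] commH2(2) by metis
        from *(1) have X'': "a' = a" "v' = v" "X'' = tester w s'"
          by (auto elim!: step_outHE simp: ren_idem)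
        have succ: "succ_in I n (Par X'' Q'') w" using Y(2) *(3) by (auto intro: succ_in_nuH)
        have "\<not> c" using Suc.prems(9) Cur_in_dom_if_vget tstep_inH by blast
        then have c: "cur_typed Q'' True" using step_cur_typed[OF *(2) Suc.prems(8)] by auto
        have Q'': "step I Q \<mu> Q''" using *(2) X'' tstep_inH by simp
        have "runs I \<Gamma>' Q'' s'"
          by (rule next_run[OF succ Q'' c]) (use X'' tstep_inH in auto)
        moreover have "tstep I \<Gamma> Q \<mu> \<Gamma>' Q''"
          using tstep_inH Q'' tstep.tstep_inH[of I Q a v b Q'' \<Gamma>] by simp
        ultimately show ?thesis unfolding Cons by (rule runs_act[rotated])
      next
        case (par2 Q')
        then show ?thesis using internal by blast
      qed (use X[unfolded T] no_tau in \<open>auto elim: step_outHE\<close>)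
    next
      case (tstep_outF h v)
      have T: "tester w (\<mu> # s') = InF (Free h) 0 (check w v (tester w s'))" using tstep_outF by simp
      from Y(1) show ?thesis
      proof (cases rule: step_ParE)
        case (commF1 h' v' X' Q')
        have X': "h' = h" "X' = psubst 0 v' (check w v (tester w s'))"
          using X[OF commF1(3)] unfolding T by (auto elim!: step_InFE)
        have succ: "succ_in I n (Par X' Q') w" using Y(2) commF1 by simp
        have "\<not> c" using Suc.prems(9) tstep_outF by blast
        then have c: "cur_typed Q' False" using step_cur_typed[OF commF1(4) Suc.prems(8)] by auto
        have v: "v' = v" using value_ok succ commF1(4) c X' by blast
        have Q': "step I Q \<mu> Q'" using commF1(4) v X' tstep_outF by simp
        have "runs I \<Gamma>' Q' s'"
          by (rule next_run[OF succ Q' c]) (use check_step v X' in auto)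
        moreover have "tstep I \<Gamma> Q \<mu> \<Gamma>' Q'"
          using tstep_outF Q' by (auto intro: tstep.tstep_outF)
        ultimately show ?thesis unfolding Cons by (rule runs_act[rotated])
      next
        case (par2 Q')
        then show ?thesis using internal by blast
      qed (use X[unfolded T] no_tau in \<open>auto elim: step_InFE\<close>)
    next
      case (tstep_inF h v)
      have T: "tester w (\<mu> # s') = OutF (Free h) (Val v) (tester w s')" using tstep_inF by simp
      from Y(1) show ?thesis
      proof (cases rule: step_ParE)
        case (commF2 h' v' X' Q')
        have X': "h' = h" "v' = v" "X' = tester w s'"
          using X[OF commF2(3)] unfolding T by (auto elim!: step_OutFE)
        have succ: "succ_in I n (Par X' Q') w" using Y(2) commF2 by simp
        have c: "cur_typed Q' True" using step_cur_typed[OF commF2(4) Suc.prems(8)] by auto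
        have Q': "step I Q \<mu> Q'" using commF2(4) X' tstep_inF by simp
        have "runs I \<Gamma>' Q' s'"
          by (rule next_run[OF succ Q' c]) (use X' tstep_inF in auto)
        moreover have "tstep I \<Gamma> Q \<mu> \<Gamma>' Q'"
          using tstep_inF Q' by (auto intro: tstep.tstep_inF)
        ultimately show ?thesis unfolding Cons by (rule runs_act[rotated])
      next
        case (par2 Q')
        then show ?thesis using internal by blast
      qed (use X[unfolded T] no_tau in \<open>auto elim: step_OutFE\<close>)
    next
      case tstep_tau
      then show ?thesis using Suc.prems(4) Cons by simp
    qed
  qed (simp add: runs_Nil)
qed

lemma trace_of_transfer:
  assumes "\<And>R. closed_proc R \<Longrightarrow> \<Gamma> \<turnstile> R \<Longrightarrow> may_succeed I (Par R P) w \<Longrightarrow> may_succeed I (Par R Q) w"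
    and "visibility \<Gamma>" "\<Delta> \<turnstile> Q" "compatible \<Delta> \<Gamma>" "w \<notin> snames Q"
    and "set (trace_bhn s) \<inter> fhn Q = {}" "trace_of I \<Gamma> P s"
  shows "trace_of I \<Gamma> Q s"
proof -
  have s: "is_trace s" "runs I \<Gamma> P s" "Tau \<notin> set s" "distinct (trace_bhn s)"
    using assms(7) by (auto simp: trace_of_def runs_def is_trace_def)
  have "may_succeed I (Par (tester w s) P) w"
    using may_succeed_if_accepts[OF accepts_tester[OF s(2,3)] s(2)] .
  then have "may_succeed I (Par (tester w s) Q) w"
    using assms(1)[OF _ typed_tester[OF s(2,3) assms(2)]] by (simp add: closed_proc_def closed_tester)
  then obtain n where "succ_in I n (Par (tester w s) Q) w" by (auto simp: may_succeed_iff_succ_in)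
  moreover have "Cur \<in> dom \<Delta> \<Longrightarrow> Cur \<notin> dom \<Gamma>" using assms(4) by (auto simp: compatible_def)
  ultimately have "runs I \<Gamma> Q s"
    using runs_if_succ_in_tester[OF _ _ s(2-4) assms(6,5) typed_cur_typed[OF assms(3)]] by blast
  with s(1) show ?thesis by (simp add: trace_of_def runs_def)
qed

theorem mainTheorem1:
  fixes I :: "'f \<Rightarrow> 'v list \<Rightarrow> 'v"
    and \<Delta> \<Gamma> :: vis
    and P Q :: "('f, 'v) proc"
  assumes "visibility \<Delta>" and "visibility \<Gamma>"
    and "closed_proc P" and "closed_proc Q"
    and "\<Delta> \<turnstile> P" and "\<Delta> \<turnstile> Q"
  shows "trace_equiv I \<Delta> \<Gamma> P Q \<longleftrightarrow> may_equiv I \<Delta> \<Gamma> P Q"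
proof
  let ?A = "fhn P \<union> fhn Q \<union> vnames \<Delta> \<union> vnames \<Gamma>"
  assume tr: "trace_equiv I \<Delta> \<Gamma> P Q"
  then have comp: "compatible \<Delta> \<Gamma>" by (simp add: trace_equiv_def)
  have eq: "trace_of I \<Gamma> P s \<longleftrightarrow> trace_of I \<Gamma> Q s" if "set (trace_bhn s) \<inter> ?A = {}" for s
    using tr that by (simp add: trace_equiv_def)
  \<comment> \<open>Trace equivalence compares only traces whose bound names avoid
    \<open>?A\<close>. Finiteness lets the decomposition of a computation produce such a
    trace.\<close>
  have A: "finite ?A" using assms(1,2) by (simp add: finite_vnames)
  have "may_succeed I (Par R P) w \<longleftrightarrow> may_succeed I (Par R Q) w"
    if "\<Gamma> \<turnstile> R" "w \<notin> snames P \<union> snames Q" for R w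
  proof
    show "may_succeed I (Par R P) w \<Longrightarrow> may_succeed I (Par R Q) w"
      using may_succeed_transfer[OF _ A _ _ assms(5) comp that(1), of I Q w] eq that(2) by auto
    show "may_succeed I (Par R Q) w \<Longrightarrow> may_succeed I (Par R P) w"
      using may_succeed_transfer[OF _ A _ _ assms(6) comp that(1), of I P w] eq that(2) by auto
  qed
  then show "may_equiv I \<Delta> \<Gamma> P Q" using comp assms(5,6) by (simp add: may_equiv_def)
next
  assume may: "may_equiv I \<Delta> \<Gamma> P Q"
  then have comp: "compatible \<Delta> \<Gamma>" by (simp add: may_equiv_def)
  \<comment> \<open>One fresh success name is enough: each trace has its own tester, but all of them
    report through \<open>w\<close>.\<close>
  obtain w where w: "w \<notin> snames P \<union> snames Q"
    using ex_new_if_finite[of "snames P \<union> snames Q"] by auto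
  have eq: "may_succeed I (Par R P) w \<longleftrightarrow> may_succeed I (Par R Q) w"
    if "closed_proc R" "\<Gamma> \<turnstile> R" for R
    using may w that by (simp add: may_equiv_def)
  have "trace_of I \<Gamma> P s \<longleftrightarrow> trace_of I \<Gamma> Q s"
    if "set (trace_bhn s) \<inter> (fhn P \<union> fhn Q \<union> vnames \<Delta> \<union> vnames \<Gamma>) = {}" for s
  proof
    show "trace_of I \<Gamma> P s \<Longrightarrow> trace_of I \<Gamma> Q s"
      using trace_of_transfer[of \<Gamma> I P w Q \<Delta> s] eq assms w comp that by auto
    show "trace_of I \<Gamma> Q s \<Longrightarrow> trace_of I \<Gamma> P s"
      using trace_of_transfer[of \<Gamma> I Q w P \<Delta> s] eq assms w comp that by auto
  qed
  then show "trace_equiv I \<Delta> \<Gamma> P Q" using comp assms(5,6) by (simp add: trace_equiv_def)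
qed

end
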